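(* Let $\alpha',\beta',\gamma'$ be nonzero real constants and let $$\Lambda=-\frac{\gamma'}{8\beta'}.$$ Let $g_{ab}$ be a four-dimensional Lorentzian metric with vanishing Bach tensor, $B_{ab}=0$ (for example, any Einstein metric), with Ricci scalar $R$, and let $\Omega$ be a nowhere vanishing function solving $$6\,\Box\Omega-R\,\Omega+4\Lambda\,\Omega^3=0$$ on the background $g_{ab}$. Then the conformally related metric $\tilde g_{ab}=\Omega^2g_{ab}$ has constant Ricci scalar $\tilde R=4\Lambda$ and solves the vacuum field equations of quadratic gravity $$\gamma'\left(\tilde R_{ab}-\tfrac12 \tilde R \tilde g_{ab}+\Lambda \tilde g_{ab}\right)-4\alpha' \tilde B_{ab}+2\beta'\left(\tilde R_{ab}-\tfrac14 \tilde R \tilde g_{ab}+\tilde g_{ab}\tilde\Box-\tilde\nabla_b\tilde\nabla_a\right)\tilde R=0 .$$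
   Context: All objects are smooth; signature $(-,+,+,+)$. $R_{ab}$, $R$, $C_{abcd}$ denote the Ricci tensor, Ricci scalar and Weyl tensor, $\Box=g^{ab}\nabla_a\nabla_b$, and the Bach tensor is $B_{ab}=(\nabla^c\nabla^d+\tfrac12R^{cd})C_{acbd}$. Quantities with a tilde are those of $\tilde g_{ab}$. A four-dimensional metric is Einstein if $R_{ab}=\tfrac14Rg_{ab}$ (with $R$ constant). *)

theory Defs
  imports "HOL-Analysis.Analysis"
begin

subsection \<open>Smooth functions on open subsets of Euclidean space\<close>

definition partial :: "'n::finite \<Rightarrow> (real^'n \<Rightarrow> real) \<Rightarrow> real^'n \<Rightarrow> real" where
  "partial i f x = frechet_derivative f (at x) (axis i 1)"

text \<open>For open \<open>S\<close>: all iterated partial derivatives exist and are (totally) differentiable,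
  hence continuous, i.e. \<open>f\<close> is of class \<open>C\<^sup>\<infinity>\<close> on \<open>S\<close>.\<close>

definition smooth_on :: "(real^'n) set \<Rightarrow> (real^'n::finite \<Rightarrow> real) \<Rightarrow> bool" where
  "smooth_on S f \<longleftrightarrow> (\<forall>idx. \<forall>x\<in>S. (foldr partial idx f) differentiable (at x))"

subsection \<open>Smooth four-manifolds\<close>

text \<open>A chart is a pair of its domain and its coordinate map.\<close>

type_synonym 'a chart = "'a set \<times> ('a \<Rightarrow> real^4)"

definition coords :: "'a chart \<Rightarrow> (real^4) set" where
  "coords c = snd c ` fst c"

definition point :: "'a chart \<Rightarrow> real^4 \<Rightarrow> 'a" where
  "point c = inv_into (fst c) (snd c)"

definition is_chart :: "'a topology \<Rightarrow> 'a chart \<Rightarrow> bool" where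
  "is_chart M c \<longleftrightarrow> openin M (fst c) \<and> open (coords c) \<and>
     homeomorphic_map (subtopology M (fst c)) (top_of_set (coords c)) (snd c)"

definition overlap :: "'a chart \<Rightarrow> 'a chart \<Rightarrow> (real^4) set" where
  "overlap c d = snd c ` (fst c \<inter> fst d)"

definition transition :: "'a chart \<Rightarrow> 'a chart \<Rightarrow> real^4 \<Rightarrow> real^4" where
  "transition c d = snd d \<circ> point c"

definition smooth_4manifold :: "'a topology \<Rightarrow> 'a chart set \<Rightarrow> bool" where
  "smooth_4manifold M A \<longleftrightarrow>
     Hausdorff_space M \<and> second_countable M \<and>
     (\<forall>c\<in>A. is_chart M c) \<and> (\<Union>c\<in>A. fst c) = topspace M \<and>
     (\<forall>c\<in>A. \<forall>d\<in>A. \<forall>i. smooth_on (overlap c d) (\<lambda>x. transition c d x $ i))"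

definition smooth_function :: "'a chart set \<Rightarrow> ('a \<Rightarrow> real) \<Rightarrow> bool" where
  "smooth_function A f \<longleftrightarrow> (\<forall>c\<in>A. smooth_on (coords c) (f \<circ> point c))"

subsection \<open>Lorentzian metrics\<close>

text \<open>A covariant 2-tensor field is given by its component matrix in each chart, as a function of
  the coordinates, subject to the tensor transformation law on overlaps.\<close>

type_synonym 'a tensor2 = "'a chart \<Rightarrow> real^4 \<Rightarrow> real^4^4"

text \<open>The index type \<open>4\<close> consists of \<open>0, 1, 2, 3\<close>; the index \<open>0\<close> is the timelike one.\<close>

definition minkowski :: "real^4^4" where
  "minkowski = (\<chi> a b. if a = b then (if a = 0 then - 1 else 1) else 0)"

definition lorentzian_form :: "real^4^4 \<Rightarrow> bool" where
  "lorentzian_form G \<longleftrightarrow> (\<exists>P. invertible P \<and> transpose P ** G ** P = minkowski)"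

definition lorentzian_metric :: "'a chart set \<Rightarrow> 'a tensor2 \<Rightarrow> bool" where
  "lorentzian_metric A g \<longleftrightarrow>
     (\<forall>c\<in>A. \<forall>a b. smooth_on (coords c) (\<lambda>x. g c x $ a $ b)) \<and>
     (\<forall>c\<in>A. \<forall>x\<in>coords c. lorentzian_form (g c x)) \<and>
     (\<forall>c\<in>A. \<forall>d\<in>A. \<forall>x\<in>overlap c d.
        g c x = transpose (jacobian (transition c d) (at x)) ** g d (transition c d x)
                  ** jacobian (transition c d) (at x))"

definition conformal_metric :: "('a \<Rightarrow> real) \<Rightarrow> 'a tensor2 \<Rightarrow> 'a tensor2" where
  "conformal_metric \<Omega> g = (\<lambda>c x. (\<Omega> (point c x))\<^sup>2 *\<^sub>R g c x)"

subsection \<open>Curvature of a metric \<open>G\<close> in coordinates\<close>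

definition ginv :: "(real^4 \<Rightarrow> real^4^4) \<Rightarrow> real^4 \<Rightarrow> 4 \<Rightarrow> 4 \<Rightarrow> real" where
  "ginv G x a b = matrix_inv (G x) $ a $ b"

text \<open>\<open>christoffel G c a b\<close> is \<open>\<Gamma>\<^sup>c\<^bsub>ab\<^esub>\<close>.\<close>

definition christoffel ::
    "(real^4 \<Rightarrow> real^4^4) \<Rightarrow> 4 \<Rightarrow> 4 \<Rightarrow> 4 \<Rightarrow> real^4 \<Rightarrow> real" where
  "christoffel G c a b x = (1/2) * (\<Sum>d\<in>UNIV. ginv G x c d *
     (partial a (\<lambda>y. G y $ b $ d) x + partial b (\<lambda>y. G y $ a $ d) x
        - partial d (\<lambda>y. G y $ a $ b) x))"

text \<open>The components \<open>T x [a\<^sub>1, \<dots>, a\<^sub>k]\<close> of a covariant \<open>k\<close>-tensor are indexed by lists, and the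
  derivative index comes first: \<open>cov_deriv G T x (e # idx)\<close> is \<open>\<nabla>\<^sub>e T\<^bsub>idx\<^esub>\<close>.  In particular
  \<open>cov_deriv G (cov_deriv G T) x [e, f, a, \<dots>]\<close> is \<open>\<nabla>\<^sub>e \<nabla>\<^sub>f T\<^bsub>a\<dots>\<^esub>\<close>.\<close>

fun cov_deriv ::
    "(real^4 \<Rightarrow> real^4^4) \<Rightarrow> (real^4 \<Rightarrow> 4 list \<Rightarrow> real) \<Rightarrow> real^4 \<Rightarrow> 4 list \<Rightarrow> real" where
  "cov_deriv G T x (e # idx) = partial e (\<lambda>y. T y idx) x
     - (\<Sum>k<length idx. \<Sum>m\<in>UNIV. christoffel G m e (idx ! k) x * T x (idx[k := m]))"
| "cov_deriv G T x [] = 0"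

definition hessian ::
    "(real^4 \<Rightarrow> real^4^4) \<Rightarrow> (real^4 \<Rightarrow> real) \<Rightarrow> real^4 \<Rightarrow> 4 \<Rightarrow> 4 \<Rightarrow> real" where
  "hessian G f x a b = cov_deriv G (cov_deriv G (\<lambda>y idx. f y)) x [a, b]"

definition box :: "(real^4 \<Rightarrow> real^4^4) \<Rightarrow> (real^4 \<Rightarrow> real) \<Rightarrow> real^4 \<Rightarrow> real" where
  "box G f x = (\<Sum>a\<in>UNIV. \<Sum>b\<in>UNIV. ginv G x a b * hessian G f x a b)"

text \<open>\<open>riemann_up G a b c d\<close> is \<open>R\<^sup>a\<^bsub>bcd\<^esub>\<close>, with the sign convention in which
  \<open>R\<^bsub>bd\<^esub> = R\<^sup>a\<^bsub>bad\<^esub>\<close> and round spheres have positive scalar curvature.\<close>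

definition riemann_up ::
    "(real^4 \<Rightarrow> real^4^4) \<Rightarrow> 4 \<Rightarrow> 4 \<Rightarrow> 4 \<Rightarrow> 4 \<Rightarrow> real^4 \<Rightarrow> real" where
  "riemann_up G a b c d x =
     partial c (christoffel G a d b) x - partial d (christoffel G a c b) x
     + (\<Sum>e\<in>UNIV. christoffel G a c e x * christoffel G e d b x
                  - christoffel G a d e x * christoffel G e c b x)"

definition riemann ::
    "(real^4 \<Rightarrow> real^4^4) \<Rightarrow> real^4 \<Rightarrow> 4 \<Rightarrow> 4 \<Rightarrow> 4 \<Rightarrow> 4 \<Rightarrow> real" where
  "riemann G x a b c d = (\<Sum>e\<in>UNIV. G x $ a $ e * riemann_up G e b c d x)"

definition ricci :: "(real^4 \<Rightarrow> real^4^4) \<Rightarrow> real^4 \<Rightarrow> 4 \<Rightarrow> 4 \<Rightarrow> real" where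
  "ricci G x b d = (\<Sum>a\<in>UNIV. riemann_up G a b a d x)"

definition scalar_curv :: "(real^4 \<Rightarrow> real^4^4) \<Rightarrow> real^4 \<Rightarrow> real" where
  "scalar_curv G x = (\<Sum>a\<in>UNIV. \<Sum>b\<in>UNIV. ginv G x a b * ricci G x a b)"

definition weyl ::
    "(real^4 \<Rightarrow> real^4^4) \<Rightarrow> real^4 \<Rightarrow> 4 \<Rightarrow> 4 \<Rightarrow> 4 \<Rightarrow> 4 \<Rightarrow> real" where
  "weyl G x a b c d = riemann G x a b c d
     - (1/2) * (G x $ a $ c * ricci G x b d - G x $ a $ d * ricci G x b c
                - G x $ b $ c * ricci G x a d + G x $ b $ d * ricci G x a c)
     + (1/6) * scalar_curv G x * (G x $ a $ c * G x $ b $ d - G x $ a $ d * G x $ b $ c)"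

definition weyl_tensor ::
    "(real^4 \<Rightarrow> real^4^4) \<Rightarrow> real^4 \<Rightarrow> 4 list \<Rightarrow> real" where
  "weyl_tensor G x idx = weyl G x (idx ! 0) (idx ! 1) (idx ! 2) (idx ! 3)"

text \<open>\<open>B\<^bsub>ab\<^esub> = (\<nabla>\<^sup>c \<nabla>\<^sup>d + R\<^sup>c\<^sup>d / 2) C\<^bsub>acbd\<^esub>\<close>, the raised indices \<open>c, d\<close> being
  written as \<open>e, f\<close> contracted with the inverse metric.\<close>

definition bach :: "(real^4 \<Rightarrow> real^4^4) \<Rightarrow> real^4 \<Rightarrow> 4 \<Rightarrow> 4 \<Rightarrow> real" where
  "bach G x a b = (\<Sum>c\<in>UNIV. \<Sum>d\<in>UNIV. \<Sum>e\<in>UNIV. \<Sum>f\<in>UNIV.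
     ginv G x c e * ginv G x d f *
       (cov_deriv G (cov_deriv G (weyl_tensor G)) x [e, f, a, c, b, d]
        + (1/2) * ricci G x e f * weyl G x a c b d))"

subsection \<open>Properties of metrics on the manifold\<close>

definition bach_flat :: "'a chart set \<Rightarrow> 'a tensor2 \<Rightarrow> bool" where
  "bach_flat A g \<longleftrightarrow> (\<forall>c\<in>A. \<forall>x\<in>coords c. \<forall>a b. bach (g c) x a b = 0)"

definition constant_scalar_curv :: "'a chart set \<Rightarrow> 'a tensor2 \<Rightarrow> real \<Rightarrow> bool" where
  "constant_scalar_curv A g k \<longleftrightarrow> (\<forall>c\<in>A. \<forall>x\<in>coords c. scalar_curv (g c) x = k)"

definition einstein :: "'a chart set \<Rightarrow> 'a tensor2 \<Rightarrow> bool" where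
  "einstein A g \<longleftrightarrow>
     (\<exists>k. constant_scalar_curv A g k) \<and>
     (\<forall>c\<in>A. \<forall>x\<in>coords c. \<forall>a b.
        ricci (g c) x a b = (1/4) * scalar_curv (g c) x * g c x $ a $ b)"

definition conformal_factor_eq ::
    "'a chart set \<Rightarrow> 'a tensor2 \<Rightarrow> real \<Rightarrow> ('a \<Rightarrow> real) \<Rightarrow> bool" where
  "conformal_factor_eq A g \<Lambda> \<Omega> \<longleftrightarrow> (\<forall>c\<in>A. \<forall>x\<in>coords c.
     6 * box (g c) (\<Omega> \<circ> point c) x - scalar_curv (g c) x * \<Omega> (point c x)
       + 4 * \<Lambda> * \<Omega> (point c x) ^ 3 = 0)"

definition quadratic_gravity_eq ::
    "'a chart set \<Rightarrow> real \<Rightarrow> real \<Rightarrow> real \<Rightarrow> real \<Rightarrow> 'a tensor2 \<Rightarrow> bool" where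
  "quadratic_gravity_eq A \<alpha> \<beta> \<gamma> \<Lambda> g \<longleftrightarrow> (\<forall>c\<in>A. \<forall>x\<in>coords c. \<forall>a b.
     \<gamma> * (ricci (g c) x a b - (1/2) * scalar_curv (g c) x * g c x $ a $ b
            + \<Lambda> * g c x $ a $ b)
     - 4 * \<alpha> * bach (g c) x a b
     + 2 * \<beta> * (ricci (g c) x a b * scalar_curv (g c) x
            - (1/4) * scalar_curv (g c) x * g c x $ a $ b * scalar_curv (g c) x
            + g c x $ a $ b * box (g c) (scalar_curv (g c)) x
            - hessian (g c) (scalar_curv (g c)) x b a) = 0)"

end

(* The curvature is conformally covariant pointwise: with u = d ln|Omega| the Riemann tensor of
   Omega^2 g is Omega^2 times that of g minus a Kulkarni-Nomizu product of g with a symmetric tensor S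
   built from u, so that the Weyl tensor only rescales, tr S = Box Omega / Omega, and the equation for
   Omega says exactly that the new scalar curvature is 4 Lambda.  The divergence of the Weyl tensor
   picks up the term u^d C_acbd.  In the second divergence the terms with the Hessian of u and with
   u u C cancel against the change of the Ricci term, and the remaining ones vanish by the cyclic
   identity; hence B becomes Omega^-2 B.  With constant scalar curvature and B = 0 the field equations
   reduce to (gamma + 8 beta Lambda) (R_ab - Lambda g_ab) = 0.  For Einstein metrics the contracted
   second Bianchi identity makes the Weyl tensor divergence free. *)

theory Submission
  imports Defs
begin

section \<open>Partial derivatives and smooth functions\<close>

text \<open>Everything is computed pointwise in one chart, where curvature is built from
  \<open>frechet_derivative\<close>; hence the groundwork on symmetry of second partials and on
  smoothness of the inverse metric. The obstacle is the size of the index sums: a fully expanded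
  component of the Bach tensor is unmanageable. Two linear operators keep the sums folded,
  \<open>ctr\<close> for a metric trace and \<open>conn\<close> for a single connection term, so
  that tensor identities become rewriting by linearity. Curvature is expressed through Christoffel
  symbols of the first kind: under rescaling of the metric by \<omega>^2 they stay \<omega>^2 times
  an expression in \<open>G\<close> and \<open>u\<close>, and the inverse metric enters only
  undifferentiated, through \<open>ctr\<close>. The dimension is felt as the trace 4 of the metric.
  With n in its place the divergence of the Weyl tensor would pick up (n - 3) u^d C_acbd, so the
  coefficient 1, on which the final cancellation rests, is special to n = 4.\<close>

lemma partial_has_derivative: "(f has_derivative f') (at x) \<Longrightarrow> partial i f x = f' (axis i 1)"
  unfolding partial_def using frechet_derivative_at by metis

lemma partial_cong:
  assumes "open U" "x \<in> U" "\<And>y. y \<in> U \<Longrightarrow> f y = h y"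
  shows "partial i f x = partial i h x"
proof -
  have "(f has_derivative D) (at x) \<longleftrightarrow> (h has_derivative D) (at x)" for D
    by (metis assms has_derivative_transform_within_open)
  then show ?thesis
    unfolding partial_def frechet_derivative_def by simp
qed

lemma differentiable_cong_open:
  assumes "open U" "x \<in> U" "\<And>y. y \<in> U \<Longrightarrow> f y = h y" "f differentiable (at x)"
  shows "h differentiable (at x)"
  using assms unfolding differentiable_def by (metis has_derivative_transform_within_open)

lemma partial_const [simp]: "partial i (\<lambda>y. c) = (\<lambda>x. 0)"
  by (simp add: partial_def fun_eq_iff)

lemma partial_add:
  assumes "f differentiable (at x)" "h differentiable (at x)"
  shows "partial i (\<lambda>y. f y + h y) x = partial i f x + partial i h x"
proof -
  from assms obtain f' h' where *: "(f has_derivative f') (at x)" "(h has_derivative h') (at x)"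
    unfolding differentiable_def by auto
  show ?thesis
    using partial_has_derivative[OF has_derivative_add[OF *]] partial_has_derivative[OF *(1)]
      partial_has_derivative[OF *(2)] by simp
qed

lemma partial_mult:
  assumes "f differentiable (at x)" "h differentiable (at x)"
  shows "partial i (\<lambda>y. f y * h y) x = partial i f x * h x + f x * partial i h x"
proof -
  from assms obtain f' h' where *: "(f has_derivative f') (at x)" "(h has_derivative h') (at x)"
    unfolding differentiable_def by auto
  show ?thesis
    using partial_has_derivative[OF has_derivative_mult[OF *]] partial_has_derivative[OF *(1)]
      partial_has_derivative[OF *(2)] by simp
qed

lemma partial_cmult:
  "f differentiable (at x) \<Longrightarrow> partial i (\<lambda>y. c * f y) x = c * partial i f x"
  using partial_mult[of "\<lambda>y. c" x f] by simp

lemma partial_minus: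
  "f differentiable (at x) \<Longrightarrow> partial i (\<lambda>y. - f y) x = - partial i f x"
  using partial_cmult[of f x i "- 1"] by simp

lemma partial_diff:
  assumes "f differentiable (at x)" "h differentiable (at x)"
  shows "partial i (\<lambda>y. f y - h y) x = partial i f x - partial i h x"
  using partial_add[of f x "\<lambda>y. - h y"] partial_minus[of h x] assms by simp

lemma partial_sum:
  assumes "finite K" "\<And>k. k \<in> K \<Longrightarrow> f k differentiable (at x)"
  shows "partial i (\<lambda>y. \<Sum>k\<in>K. f k y) x = (\<Sum>k\<in>K. partial i (f k) x)"
  using assms
proof (induction K rule: finite_induct)
  case (insert k K)
  have "(\<lambda>y. \<Sum>k\<in>K. f k y) differentiable (at x)"
    using insert by (intro differentiable_sum) auto
  then show ?case
    using insert by (simp add: partial_add)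
qed simp

lemma partial_inverse:
  fixes f :: "real^'n::finite \<Rightarrow> real"
  assumes "f differentiable (at x)" "f x \<noteq> 0"
  shows "partial i (\<lambda>y. inverse (f y)) x = - (partial i f x * (inverse (f x) * inverse (f x)))"
proof -
  from assms obtain f' where *: "(f has_derivative f') (at x)"
    unfolding differentiable_def by auto
  show ?thesis
    using partial_has_derivative[OF Deriv.has_derivative_inverse[OF assms(2) *]]
      partial_has_derivative[OF *] by simp
qed

subsection \<open>Symmetry of second derivatives\<close>

text \<open>The core of Schwarz's theorem in Young's form. The second difference is symmetric in the
  two directions, while the estimate ties it to one order of differentiation; using it in both
  orders yields \<open>partial_commute\<close>.\<close>

lemma second_difference_estimate:
  fixes f :: "real^'n::finite \<Rightarrow> real" and i j :: 'n and x :: "real^'n"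
  assumes "open U" "x \<in> U" "\<And>y. y \<in> U \<Longrightarrow> f differentiable (at y)"
    and "partial i f differentiable (at x)" and "\<epsilon> > 0"
  defines "u \<equiv> axis i 1" and "v \<equiv> axis j 1"
  obtains \<delta> where "\<delta> > 0"
    "\<And>s. 0 < s \<Longrightarrow> s < \<delta> \<Longrightarrow>
       \<bar>f (x + s *\<^sub>R u + s *\<^sub>R v) - f (x + s *\<^sub>R u) - f (x + s *\<^sub>R v) + f x
         - s * s * partial j (partial i f) x\<bar> \<le> \<epsilon> * (s * s)"
proof -
  have norm_uv [simp]: "norm u = 1" "norm v = 1"
    by (simp_all add: u_def v_def)
  obtain L where L: "(partial i f has_derivative L) (at x)"
    using assms(4) unfolding differentiable_def by auto
  have Lv: "partial j (partial i f) x = L v"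
    using partial_has_derivative[OF L] by (simp add: v_def)
  have lin: "linear L"
    using L has_derivative_linear by blast
  from L have "\<forall>e>0. \<exists>d>0. \<forall>y. norm (y - x) < d \<longrightarrow>
      norm (partial i f y - partial i f x - L (y - x)) \<le> e * norm (y - x)"
    unfolding has_derivative_at_alt by blast
  \<comment> \<open>The linearisation is used at two displacements, of norm at most
    \<open>2 * s\<close> and at most \<open>s\<close>; their errors add up to
    \<open>\<epsilon> * s\<close>.\<close>
  moreover have "\<epsilon> / 3 > 0" using assms(5) by simp
  ultimately obtain d where d: "d > 0"
    "\<And>y. norm (y - x) < d \<Longrightarrow>
      norm (partial i f y - partial i f x - L (y - x)) \<le> \<epsilon> / 3 * norm (y - x)"
    by blast
  obtain r where r: "r > 0" "ball x r \<subseteq> U"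
    using assms(1,2) open_contains_ball by blast
  \<comment> \<open>Halved because a displacement along both directions has norm up to
    \<open>2 * s\<close>.\<close>
  define \<delta> where "\<delta> = min d r / 2"
  have "\<delta> > 0" using d r by (simp add: \<delta>_def)
  moreover
  have "\<bar>f (x + s *\<^sub>R u + s *\<^sub>R v) - f (x + s *\<^sub>R u) - f (x + s *\<^sub>R v) + f x
         - s * s * partial j (partial i f) x\<bar> \<le> \<epsilon> * (s * s)" if s: "0 < s" "s < \<delta>" for s
  proof -
    have small: "norm (t *\<^sub>R u + w *\<^sub>R v) \<le> 2 * s" if "0 \<le> t" "t \<le> s" "0 \<le> w" "w \<le> s" for t w
      using norm_triangle_ineq[of "t *\<^sub>R u" "w *\<^sub>R v"] that by simp
    have inU: "x + (t *\<^sub>R u + w *\<^sub>R v) \<in> U" if "0 \<le> t" "t \<le> s" "0 \<le> w" "w \<le> s" for t w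
    proof -
      have "dist x (x + (t *\<^sub>R u + w *\<^sub>R v)) = norm (t *\<^sub>R u + w *\<^sub>R v)"
        by (metis add_diff_cancel_left' dist_commute dist_norm)
      then show ?thesis
        using small[OF that] r s by (auto simp: \<delta>_def subset_iff)
    qed
    \<comment> \<open>The second difference is the increment of \<open>\<phi>\<close> over
      \<open>[0, s]\<close>. The mean value theorem replaces it by \<open>s * \<phi>' \<xi>\<close>,
      which involves only first partials.\<close>
    define \<phi> where "\<phi> t = f (x + (t *\<^sub>R u + s *\<^sub>R v)) - f (x + (t *\<^sub>R u + 0 *\<^sub>R v))" for t
    define \<phi>' where "\<phi>' t = partial i f (x + (t *\<^sub>R u + s *\<^sub>R v)) - partial i f (x + (t *\<^sub>R u + 0 *\<^sub>R v))"
      for t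
    have D: "((\<lambda>t. f (x + (t *\<^sub>R u + w *\<^sub>R v))) has_real_derivative
          partial i f (x + (t *\<^sub>R u + w *\<^sub>R v))) (at t)"
      if "0 \<le> t" "t \<le> s" "0 \<le> w" "w \<le> s" for t w
    proof -
      let ?y = "x + (t *\<^sub>R u + w *\<^sub>R v)"
      have "f differentiable (at ?y)"
        using assms(3)[OF inU[OF that]] .
      then obtain f' where f': "(f has_derivative f') (at ?y)"
        unfolding differentiable_def by auto
      have "((\<lambda>t. x + (t *\<^sub>R u + w *\<^sub>R v)) has_derivative (\<lambda>h. h *\<^sub>R u)) (at t)"
        by (auto intro!: derivative_eq_intros)
      from has_derivative_compose[OF this f']
      have "((\<lambda>t. f (x + (t *\<^sub>R u + w *\<^sub>R v))) has_derivative (\<lambda>h. f' (h *\<^sub>R u))) (at t)" .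
      moreover have "f' (h *\<^sub>R u) = partial i f ?y * h" for h
        using linear_scale[OF has_derivative_linear[OF f'], of h u] partial_has_derivative[OF f', of i]
        by (simp add: u_def)
      ultimately show ?thesis
        by (simp add: has_field_derivative_def fun_eq_iff)
    qed
    have "\<exists>\<xi>. 0 < \<xi> \<and> \<xi> < s \<and> \<phi> s - \<phi> 0 = (s - 0) * \<phi>' \<xi>"
      using s unfolding \<phi>_def \<phi>'_def
      by (intro MVT2 DERIV_diff D) auto
    then obtain \<xi> where \<xi>: "0 < \<xi>" "\<xi> < s" "\<phi> s - \<phi> 0 = s * \<phi>' \<xi>" by auto
    have est: "\<bar>partial i f (x + (\<xi> *\<^sub>R u + w *\<^sub>R v)) - partial i f x - L (\<xi> *\<^sub>R u + w *\<^sub>R v)\<bar>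
        \<le> \<epsilon> / 3 * norm (\<xi> *\<^sub>R u + w *\<^sub>R v)" if "0 \<le> w" "w \<le> s" for w
      using d(2)[of "x + (\<xi> *\<^sub>R u + w *\<^sub>R v)"] small[of \<xi> w] that \<xi> s
      by (auto simp: \<delta>_def)
    have "\<bar>partial i f (x + (\<xi> *\<^sub>R u + s *\<^sub>R v)) - partial i f x - L (\<xi> *\<^sub>R u + s *\<^sub>R v)\<bar>
        \<le> \<epsilon> / 3 * (2 * s)"
    proof -
      have "\<epsilon> / 3 * norm (\<xi> *\<^sub>R u + s *\<^sub>R v) \<le> \<epsilon> / 3 * (2 * s)"
        using small[of \<xi> s] \<xi> s assms(5) by (intro mult_left_mono) auto
      with est[of s] s show ?thesis by simp
    qed
    moreover have "\<bar>partial i f (x + (\<xi> *\<^sub>R u + 0 *\<^sub>R v)) - partial i f x - L (\<xi> *\<^sub>R u + 0 *\<^sub>R v)\<bar>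
        \<le> \<epsilon> / 3 * s"
    proof -
      have "\<epsilon> / 3 * norm (\<xi> *\<^sub>R u + 0 *\<^sub>R v) \<le> \<epsilon> / 3 * s"
        using \<xi> assms(5) by (intro mult_left_mono) auto
      with est[of 0] s show ?thesis by simp
    qed
    moreover have "L (\<xi> *\<^sub>R u + s *\<^sub>R v) = L (\<xi> *\<^sub>R u + 0 *\<^sub>R v) + s * L v"
      using lin by (simp add: linear_add linear_scale)
    ultimately have "\<bar>\<phi>' \<xi> - s * L v\<bar> \<le> \<epsilon> * s"
      unfolding \<phi>'_def by argo
    then have "s * \<bar>\<phi>' \<xi> - s * L v\<bar> \<le> s * (\<epsilon> * s)"
      using s by (intro mult_left_mono) auto
    then have "\<bar>s * (\<phi>' \<xi> - s * L v)\<bar> \<le> s * (\<epsilon> * s)"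
      using s by (simp add: abs_mult)
    moreover have "f (x + s *\<^sub>R u + s *\<^sub>R v) - f (x + s *\<^sub>R u) - f (x + s *\<^sub>R v) + f x
        = \<phi> s - \<phi> 0"
      unfolding \<phi>_def by (simp add: algebra_simps)
    ultimately show ?thesis
      unfolding Lv \<xi>(3) by (simp add: algebra_simps)
  qed
  ultimately show thesis using that by blast
qed

lemma partial_commute:
  fixes f :: "real^'n::finite \<Rightarrow> real"
  assumes "open U" "x \<in> U" "\<And>y. y \<in> U \<Longrightarrow> f differentiable (at y)"
    and "partial i f differentiable (at x)" "partial j f differentiable (at x)"
  shows "partial j (partial i f) x = partial i (partial j f) x"
proof (rule ccontr)
  assume neq: "partial j (partial i f) x \<noteq> partial i (partial j f) x"
  let ?p = "partial j (partial i f) x" and ?q = "partial i (partial j f) x"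
  let ?u = "axis i 1 :: real^'n" and ?v = "axis j 1 :: real^'n"
  \<comment> \<open>The two estimates together allow a gap of \<open>2 * \<epsilon>\<close>, whereas
    the assumed gap is \<open>4 * \<epsilon>\<close>.\<close>
  define \<epsilon> where "\<epsilon> = \<bar>?p - ?q\<bar> / 4"
  have \<epsilon>: "\<epsilon> > 0" using neq by (simp add: \<epsilon>_def)
  obtain d1 where d1: "d1 > 0" "\<And>s. 0 < s \<Longrightarrow> s < d1 \<Longrightarrow>
      \<bar>f (x + s *\<^sub>R ?u + s *\<^sub>R ?v) - f (x + s *\<^sub>R ?u) - f (x + s *\<^sub>R ?v) + f x - s * s * ?p\<bar>
        \<le> \<epsilon> * (s * s)"
    using second_difference_estimate[OF assms(1-4) \<epsilon>] by blast
  obtain d2 where d2: "d2 > 0" "\<And>s. 0 < s \<Longrightarrow> s < d2 \<Longrightarrow>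
      \<bar>f (x + s *\<^sub>R ?v + s *\<^sub>R ?u) - f (x + s *\<^sub>R ?v) - f (x + s *\<^sub>R ?u) + f x - s * s * ?q\<bar>
        \<le> \<epsilon> * (s * s)"
    using second_difference_estimate[OF assms(1-3,5) \<epsilon>] by blast
  define s where "s = min d1 d2 / 2"
  have s: "0 < s" "s < d1" "s < d2" using d1 d2 by (auto simp: s_def)
  have "x + s *\<^sub>R ?v + s *\<^sub>R ?u = x + s *\<^sub>R ?u + s *\<^sub>R ?v" by simp
  from d2(2)[OF s(1,3), unfolded this] d1(2)[OF s(1,2)]
  have "\<bar>s * s * ?p - s * s * ?q\<bar> \<le> 2 * (\<epsilon> * (s * s))"
    by linarith
  moreover have "\<bar>s * s * ?p - s * s * ?q\<bar> = s * s * (4 * \<epsilon>)"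
    unfolding \<epsilon>_def right_diff_distrib[symmetric] by (simp add: abs_mult)
  moreover have "s * s * \<epsilon> > 0" using s \<epsilon> by simp
  ultimately show False by (simp add: mult.commute)
qed

subsection \<open>Closure properties of smooth functions\<close>

text \<open>The order of differentiability makes closure under products and inverses an induction in
  which the Leibniz terms are of lower order.\<close>

fun smooth_upto :: "nat \<Rightarrow> (real^'n) set \<Rightarrow> (real^'n::finite \<Rightarrow> real) \<Rightarrow> bool" where
  "smooth_upto 0 S f \<longleftrightarrow> (\<forall>x\<in>S. f differentiable (at x))"
| "smooth_upto (Suc n) S f \<longleftrightarrow>
     (\<forall>x\<in>S. f differentiable (at x)) \<and> (\<forall>i. smooth_upto n S (partial i f))"

lemma smooth_upto_iff:
  "smooth_upto n S f \<longleftrightarrow>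
     (\<forall>idx. length idx \<le> n \<longrightarrow> (\<forall>x\<in>S. foldr partial idx f differentiable (at x)))"
proof (induction n arbitrary: f)
  case (Suc n)
  show ?case (is "_ \<longleftrightarrow> ?R")
  proof
    assume L: "smooth_upto (Suc n) S f"
    show ?R
    proof (intro allI impI)
      fix idx :: "'a list" assume "length idx \<le> Suc n"
      \<comment> \<open>\<open>foldr\<close> applies the last list entry first, so the innermost
        derivative is split off at the end of the list.\<close>
      with L Suc show "\<forall>x\<in>S. foldr partial idx f differentiable (at x)"
        by (cases idx rule: rev_cases) auto
    qed
  next
    assume R: ?R
    have "\<forall>x\<in>S. foldr partial idx (partial i f) differentiable (at x)" if "length idx \<le> n" for i idx
      using R[rule_format, of "idx @ [i]"] that by auto
    moreover have "\<forall>x\<in>S. f differentiable (at x)"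
      using R[rule_format, of "[]"] by auto
    ultimately show "smooth_upto (Suc n) S f" using Suc by auto
  qed
qed auto

lemma smooth_on_iff: "smooth_on S f \<longleftrightarrow> (\<forall>n. smooth_upto n S f)"
  unfolding smooth_on_def smooth_upto_iff by auto

lemma smooth_on_differentiable: "smooth_on S f \<Longrightarrow> x \<in> S \<Longrightarrow> f differentiable (at x)"
  unfolding smooth_on_iff by (meson smooth_upto.simps(1))

lemma smooth_on_partial: "smooth_on S f \<Longrightarrow> smooth_on S (partial i f)"
  unfolding smooth_on_iff by (meson smooth_upto.simps(2))

lemma smooth_upto_Suc: "smooth_upto (Suc n) S f \<Longrightarrow> smooth_upto n S f"
  unfolding smooth_upto_iff by auto

lemma smooth_upto_cong:
  assumes "open S" "smooth_upto n S f" "\<And>x. x \<in> S \<Longrightarrow> f x = h x"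
  shows "smooth_upto n S h"
  using assms(2,3)
proof (induction n arbitrary: f h)
  case 0
  then have "h differentiable (at x)" if "x \<in> S" for x
    using differentiable_cong_open[OF assms(1) that, of f h] that by simp
  then show ?case by simp
next
  case (Suc n)
  have "partial i f x = partial i h x" if "x \<in> S" for i x
    using partial_cong[OF assms(1) that] Suc(3) by blast
  then have "smooth_upto n S (partial i h)" for i
    using Suc(1)[of "partial i f"] Suc(2) by simp
  moreover have "h differentiable (at x)" if "x \<in> S" for x
    using differentiable_cong_open[OF assms(1) that, of f h] Suc(2,3) that by simp
  ultimately show ?case by simp
qed

lemma smooth_upto_const: "smooth_upto n S (\<lambda>x. c)"
  by (induction n arbitrary: c) auto

lemma smooth_upto_add:
  assumes "open S" "smooth_upto n S f" "smooth_upto n S h"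
  shows "smooth_upto n S (\<lambda>x. f x + h x)"
  using assms(2,3)
proof (induction n arbitrary: f h)
  case (Suc n)
  have "smooth_upto n S (partial i (\<lambda>x. f x + h x))" for i
    by (rule smooth_upto_cong[OF assms(1), of _ "\<lambda>x. partial i f x + partial i h x"])
      (use Suc in \<open>auto simp: partial_add\<close>)
  then show ?case using Suc by auto
qed auto

lemma smooth_upto_mult:
  assumes "open S" "smooth_upto n S f" "smooth_upto n S h"
  shows "smooth_upto n S (\<lambda>x. f x * h x)"
  using assms(2,3)
proof (induction n arbitrary: f h)
  case (Suc n)
  have "smooth_upto n S (partial i (\<lambda>x. f x * h x))" for i
  proof (rule smooth_upto_cong[OF assms(1), of _ "\<lambda>x. partial i f x * h x + f x * partial i h x"])
    show "smooth_upto n S (\<lambda>x. partial i f x * h x + f x * partial i h x)"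
      using Suc.prems smooth_upto_Suc[OF Suc.prems(1)] smooth_upto_Suc[OF Suc.prems(2)]
      by (intro smooth_upto_add assms(1) Suc.IH) simp_all
  qed (use Suc in \<open>auto simp: partial_mult\<close>)
  then show ?case using Suc by auto
qed auto

lemma smooth_upto_inverse:
  assumes "open S" "smooth_upto n S f" "\<And>x. x \<in> S \<Longrightarrow> f x \<noteq> 0"
  shows "smooth_upto n S (\<lambda>x. inverse (f x))"
  using assms(2)
proof (induction n)
  case 0
  then show ?case using assms(3) by auto
next
  case (Suc n)
  have inv: "smooth_upto n S (\<lambda>x. inverse (f x))"
    using Suc smooth_upto_Suc by blast
  have "smooth_upto n S (partial i (\<lambda>x. inverse (f x)))" for i
  proof (rule smooth_upto_cong[OF assms(1),
        of _ "\<lambda>x. (- 1) * (partial i f x * (inverse (f x) * inverse (f x)))"])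
    show "smooth_upto n S (\<lambda>x. (- 1) * (partial i f x * (inverse (f x) * inverse (f x))))"
      using Suc by (intro smooth_upto_mult assms(1) inv smooth_upto_const) auto
  qed (use Suc assms(3) in \<open>auto simp: partial_inverse\<close>)
  then show ?case using Suc assms(3) by auto
qed

lemma smooth_on_cong:
  "open S \<Longrightarrow> smooth_on S f \<Longrightarrow> (\<And>x. x \<in> S \<Longrightarrow> f x = h x) \<Longrightarrow> smooth_on S h"
  unfolding smooth_on_iff using smooth_upto_cong by blast

lemma smooth_on_const: "smooth_on S (\<lambda>x. c)"
  by (simp add: smooth_on_iff smooth_upto_const)

lemma smooth_on_add:
  "open S \<Longrightarrow> smooth_on S f \<Longrightarrow> smooth_on S h \<Longrightarrow> smooth_on S (\<lambda>x. f x + h x)"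
  unfolding smooth_on_iff using smooth_upto_add by blast

lemma smooth_on_mult:
  "open S \<Longrightarrow> smooth_on S f \<Longrightarrow> smooth_on S h \<Longrightarrow> smooth_on S (\<lambda>x. f x * h x)"
  unfolding smooth_on_iff using smooth_upto_mult by blast

lemma smooth_on_minus: "open S \<Longrightarrow> smooth_on S f \<Longrightarrow> smooth_on S (\<lambda>x. - f x)"
  using smooth_on_mult[OF _ smooth_on_const[of S "- 1"]] by simp

lemma smooth_on_diff:
  "open S \<Longrightarrow> smooth_on S f \<Longrightarrow> smooth_on S h \<Longrightarrow> smooth_on S (\<lambda>x. f x - h x)"
  using smooth_on_add[OF _ _ smooth_on_minus] by fastforce

lemma smooth_on_inverse:
  "open S \<Longrightarrow> smooth_on S f \<Longrightarrow> (\<And>x. x \<in> S \<Longrightarrow> f x \<noteq> 0) \<Longrightarrow> smooth_on S (\<lambda>x. inverse (f x))"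
  unfolding smooth_on_iff using smooth_upto_inverse by blast

lemma smooth_on_divide:
  "open S \<Longrightarrow> smooth_on S f \<Longrightarrow> smooth_on S h \<Longrightarrow> (\<And>x. x \<in> S \<Longrightarrow> h x \<noteq> 0) \<Longrightarrow>
     smooth_on S (\<lambda>x. f x / h x)"
  unfolding divide_inverse by (intro smooth_on_mult smooth_on_inverse)

lemma smooth_on_sum:
  assumes "open S" "\<And>k. k \<in> K \<Longrightarrow> smooth_on S (f k)"
  shows "smooth_on S (\<lambda>x. \<Sum>k\<in>K. f k x)"
  using assms(2)
  by (induction K rule: infinite_finite_induct)
    (auto intro: smooth_on_const smooth_on_add assms(1))

lemma smooth_on_prod:
  assumes "open S" "\<And>k. k \<in> K \<Longrightarrow> smooth_on S (f k)"
  shows "smooth_on S (\<lambda>x. \<Prod>k\<in>K. f k x)"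
  using assms(2)
  by (induction K rule: infinite_finite_induct)
    (auto intro: smooth_on_const smooth_on_mult assms(1))

lemmas smooth_on_intros = smooth_on_const smooth_on_add smooth_on_mult smooth_on_minus
  smooth_on_diff smooth_on_sum smooth_on_partial

lemma partial_commute_smooth:
  assumes "open S" "smooth_on S f" "x \<in> S"
  shows "partial j (partial i f) x = partial i (partial j f) x"
  using assms by (intro partial_commute[of S] smooth_on_differentiable[of S] smooth_on_partial)

lemma smooth_on_det:
  fixes A :: "real^'n::finite \<Rightarrow> real^'m^'m"
  assumes "open S" "\<And>i j. smooth_on S (\<lambda>x. A x $ i $ j)"
  shows "smooth_on S (\<lambda>x. det (A x))"
  unfolding det_def using assms by (intro smooth_on_sum smooth_on_mult smooth_on_prod smooth_on_const)

lemma matrix_inv_mult: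
  fixes A :: "real^'m^'m"
  assumes "invertible A"
  shows "A ** matrix_inv A = mat 1" "matrix_inv A ** A = mat 1"
  using assms unfolding invertible_def matrix_inv_def by (metis (mono_tags, lifting) someI_ex)+

text \<open>By Cramer's rule an entry of the inverse is a quotient of two determinants, each
  polynomial in smooth functions.\<close>

lemma smooth_on_matrix_inv:
  fixes A :: "real^'n::finite \<Rightarrow> real^'m^'m"
  assumes "open S" "\<And>i j. smooth_on S (\<lambda>x. A x $ i $ j)" "\<And>x. x \<in> S \<Longrightarrow> invertible (A x)"
  shows "smooth_on S (\<lambda>x. matrix_inv (A x) $ k $ l)"
proof (rule smooth_on_cong[OF assms(1)])
  let ?N = "\<lambda>x. (\<chi> i j. if j = k then axis l 1 $ i else A x $ i $ j) :: real^'m^'m"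
  show "smooth_on S (\<lambda>x. det (?N x) / det (A x))"
  proof (intro smooth_on_divide smooth_on_det assms)
    show "smooth_on S (\<lambda>x. ?N x $ i $ j)" for i j
      using assms(2) smooth_on_const by (cases "j = k") auto
  qed (use assms(3) invertible_det_nz in auto)
  fix x assume "x \<in> S"
  with assms(3) have inv: "invertible (A x)" by blast
  have "A x *v (matrix_inv (A x) *v axis l 1) = axis l 1"
    using matrix_inv_mult[OF inv] by (simp add: matrix_vector_mul_assoc)
  then have "matrix_inv (A x) *v axis l 1
      = (\<chi> k. det (\<chi> i j. if j = k then axis l 1 $ i else A x $ i $ j) / det (A x))"
    using cramer inv invertible_det_nz by blast
  then have "(matrix_inv (A x) *v axis l 1) $ k = det (?N x) / det (A x)"
    by simp
  then show "det (?N x) / det (A x) = matrix_inv (A x) $ k $ l"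
    by (simp add: matrix_vector_mul_component column_def matrix_vector_mult_basis)
qed

section \<open>Contraction and the Levi-Civita connection\<close>

text \<open>The trace g^ab T_ab, kept as an operator on component functions so that nested
  contractions need no expansion.\<close>

definition ctr :: "(real^4 \<Rightarrow> real^4^4) \<Rightarrow> real^4 \<Rightarrow> (4 \<Rightarrow> 4 \<Rightarrow> real) \<Rightarrow> real" where
  "ctr G x T = (\<Sum>a\<in>UNIV. \<Sum>b\<in>UNIV. ginv G x a b * T a b)"

lemma ctr_add: "ctr G x (\<lambda>a b. S a b + T a b) = ctr G x S + ctr G x T"
  by (simp add: ctr_def distrib_left sum.distrib)

lemma ctr_diff: "ctr G x (\<lambda>a b. S a b - T a b) = ctr G x S - ctr G x T"
  by (simp add: ctr_def right_diff_distrib sum_subtractf)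

lemma ctr_minus: "ctr G x (\<lambda>a b. - T a b) = - ctr G x T"
  by (simp add: ctr_def sum_negf)

lemma ctr_cmult: "ctr G x (\<lambda>a b. k * T a b) = k * ctr G x T"
  by (simp add: ctr_def sum_distrib_left mult.left_commute)

lemma ctr_multc: "ctr G x (\<lambda>a b. T a b * k) = ctr G x T * k"
  using ctr_cmult[of G x k T] by (simp add: mult.commute)

lemma ctr_zero: "ctr G x (\<lambda>a b. 0) = 0"
  by (simp add: ctr_def)

lemmas ctr_linear = ctr_add ctr_diff ctr_minus ctr_cmult ctr_multc ctr_zero

lemma ctr_sum: "ctr G x (\<lambda>a b. \<Sum>k\<in>K. T k a b) = (\<Sum>k\<in>K. ctr G x (T k))"
  by (induction K rule: infinite_finite_induct) (simp_all add: ctr_zero ctr_add)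

lemma ctr_ctr:
  "ctr G x (\<lambda>a b. ctr G x (\<lambda>c d. T a b c d)) = ctr G x (\<lambda>c d. ctr G x (\<lambda>a b. T a b c d))"
proof -
  have "ctr G x (\<lambda>a b. ctr G x (\<lambda>c d. T a b c d))
      = (\<Sum>a\<in>UNIV. \<Sum>b\<in>UNIV. ginv G x a b * ctr G x (\<lambda>c d. T a b c d))"
    by (simp add: ctr_def)
  also have "\<dots> = (\<Sum>a\<in>UNIV. \<Sum>b\<in>UNIV. ctr G x (\<lambda>c d. ginv G x a b * T a b c d))"
    by (simp add: ctr_cmult)
  also have "\<dots> = ctr G x (\<lambda>c d. ctr G x (\<lambda>a b. T a b c d))"
    by (simp add: ctr_def[of G x "\<lambda>a b. T a b _ _"] ctr_sum)
  finally show ?thesis .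
qed

text \<open>\<open>conn G x e a F\<close> is the connection term \<open>\<Gamma>\<^sup>m\<^bsub>ea\<^esub> F\<^sub>m\<close>.\<close>

definition conn :: "(real^4 \<Rightarrow> real^4^4) \<Rightarrow> real^4 \<Rightarrow> 4 \<Rightarrow> 4 \<Rightarrow> (4 \<Rightarrow> real) \<Rightarrow> real" where
  "conn G x e a F = (\<Sum>m\<in>UNIV. christoffel G m e a x * F m)"

lemma conn_add: "conn G x e a (\<lambda>m. S m + T m) = conn G x e a S + conn G x e a T"
  by (simp add: conn_def distrib_left sum.distrib)

lemma conn_diff: "conn G x e a (\<lambda>m. S m - T m) = conn G x e a S - conn G x e a T"
  by (simp add: conn_def right_diff_distrib sum_subtractf)

lemma conn_minus: "conn G x e a (\<lambda>m. - T m) = - conn G x e a T"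
  by (simp add: conn_def sum_negf)

lemma conn_cmult: "conn G x e a (\<lambda>m. k * T m) = k * conn G x e a T"
  by (simp add: conn_def sum_distrib_left mult.left_commute)

lemma conn_multc: "conn G x e a (\<lambda>m. T m * k) = conn G x e a T * k"
  using conn_cmult[of G x e a k T] by (simp add: mult.commute)

lemma conn_zero: "conn G x e a (\<lambda>m. 0) = 0"
  by (simp add: conn_def)

lemmas conn_linear = conn_add conn_diff conn_minus conn_cmult conn_multc conn_zero

lemma conn_ctr:
  "conn G x e c (\<lambda>m. ctr G' x (\<lambda>a b. T m a b)) = ctr G' x (\<lambda>a b. conn G x e c (\<lambda>m. T m a b))"
  by (simp add: conn_def ctr_sum flip: ctr_cmult)

section \<open>Covariant derivatives at fixed rank\<close>

lemma cov_deriv0: "cov_deriv G T x [e] = partial e (\<lambda>y. T y []) x"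
  by simp

lemma cov_deriv1:
  "cov_deriv G T x [e, a] = partial e (\<lambda>y. T y [a]) x - conn G x e a (\<lambda>m. T x [m])"
  by (simp add: conn_def)

lemma cov_deriv2:
  "cov_deriv G T x [e, a, b] = partial e (\<lambda>y. T y [a, b]) x
     - (conn G x e a (\<lambda>m. T x [m, b]) + conn G x e b (\<lambda>m. T x [a, m]))"
  by (simp add: conn_def lessThan_Suc)

lemma cov_deriv3:
  "cov_deriv G T x [e, a, b, c] = partial e (\<lambda>y. T y [a, b, c]) x
     - (conn G x e a (\<lambda>m. T x [m, b, c]) + conn G x e b (\<lambda>m. T x [a, m, c])
        + conn G x e c (\<lambda>m. T x [a, b, m]))"
  by (simp add: conn_def lessThan_Suc)

lemma cov_deriv4:
  "cov_deriv G T x [e, a, b, c, d] = partial e (\<lambda>y. T y [a, b, c, d]) x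
     - (conn G x e a (\<lambda>m. T x [m, b, c, d]) + conn G x e b (\<lambda>m. T x [a, m, c, d])
        + conn G x e c (\<lambda>m. T x [a, b, m, d]) + conn G x e d (\<lambda>m. T x [a, b, c, m]))"
  by (simp add: conn_def lessThan_Suc)

lemma cov_deriv5:
  "cov_deriv G T x [e, f, a, b, c, d] = partial e (\<lambda>y. T y [f, a, b, c, d]) x
     - (conn G x e f (\<lambda>m. T x [m, a, b, c, d]) + conn G x e a (\<lambda>m. T x [f, m, b, c, d])
        + conn G x e b (\<lambda>m. T x [f, a, m, c, d])
        + conn G x e c (\<lambda>m. T x [f, a, b, m, d]) + conn G x e d (\<lambda>m. T x [f, a, b, c, m]))"
  by (simp add: conn_def lessThan_Suc)

lemma cov_deriv_cong:
  assumes "open U" "x \<in> U" "\<And>y idx. y \<in> U \<Longrightarrow> S y idx = T y idx"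
  shows "cov_deriv G S x idx = cov_deriv G T x idx"
proof (cases idx)
  case (Cons e l)
  have "partial e (\<lambda>y. S y l) x = partial e (\<lambda>y. T y l) x"
    using assms by (intro partial_cong[of U]) auto
  then show ?thesis using Cons assms by simp
qed simp

text \<open>Christoffel symbols of the first kind: \<open>christoffel1 G n a b\<close> is \<open>\<Gamma>\<^bsub>nab\<^esub>\<close>.\<close>

definition christoffel1 ::
    "(real^4 \<Rightarrow> real^4^4) \<Rightarrow> 4 \<Rightarrow> 4 \<Rightarrow> 4 \<Rightarrow> real^4 \<Rightarrow> real" where
  "christoffel1 G n a b x = (1/2) * (partial a (\<lambda>y. G y $ b $ n) x + partial b (\<lambda>y. G y $ a $ n) x
        - partial n (\<lambda>y. G y $ a $ b) x)"

lemma christoffel_eq_christoffel1: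
  "christoffel G c a b x = (\<Sum>n\<in>UNIV. ginv G x c n * christoffel1 G n a b x)"
  by (simp add: christoffel_def christoffel1_def sum_distrib_left algebra_simps)

lemma conn_eq_ctr: "conn G x a b F = ctr G x (\<lambda>m n. christoffel1 G n a b x * F m)"
  by (simp add: conn_def ctr_def christoffel_eq_christoffel1 sum_distrib_right mult.assoc)

section \<open>A nondegenerate metric on a coordinate patch, and its inverse\<close>

locale coord_metric =
  fixes U :: "(real^4) set" and G :: "real^4 \<Rightarrow> real^4^4"
  assumes open_U: "open U"
    and smooth_G: "\<And>a b. smooth_on U (\<lambda>x. G x $ a $ b)"
    and G_invertible: "\<And>x. x \<in> U \<Longrightarrow> invertible (G x)"
    and G_sym: "\<And>x a b. x \<in> U \<Longrightarrow> G x $ a $ b = G x $ b $ a"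
begin

lemma G_ginv:
  assumes "x \<in> U"
  shows "(\<Sum>m\<in>UNIV. G x $ a $ m * ginv G x m b) = (if a = b then 1 else 0)"
proof -
  have "(G x ** matrix_inv (G x)) $ a $ b = (mat 1 :: real^4^4) $ a $ b"
    using matrix_inv_mult[OF G_invertible[OF assms]] by simp
  then show ?thesis by (simp add: matrix_matrix_mult_def mat_def ginv_def)
qed

lemma ginv_G:
  assumes "x \<in> U"
  shows "(\<Sum>m\<in>UNIV. ginv G x a m * G x $ m $ b) = (if a = b then 1 else 0)"
proof -
  have "(matrix_inv (G x) ** G x) $ a $ b = (mat 1 :: real^4^4) $ a $ b"
    using matrix_inv_mult[OF G_invertible[OF assms]] by simp
  then show ?thesis by (simp add: matrix_matrix_mult_def mat_def ginv_def)
qed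

lemma G_ginv_contract:
  assumes "x \<in> U"
  shows "(\<Sum>m\<in>UNIV. G x $ a $ m * (\<Sum>n\<in>UNIV. ginv G x m n * F n)) = F a"
proof -
  have "(\<Sum>m\<in>UNIV. G x $ a $ m * (\<Sum>n\<in>UNIV. ginv G x m n * F n))
      = (\<Sum>m\<in>UNIV. \<Sum>n\<in>UNIV. G x $ a $ m * ginv G x m n * F n)"
    by (simp add: sum_distrib_left mult.assoc)
  also have "\<dots> = (\<Sum>n\<in>UNIV. \<Sum>m\<in>UNIV. G x $ a $ m * ginv G x m n * F n)"
    by (rule sum.swap)
  also have "\<dots> = (\<Sum>n\<in>UNIV. (if a = n then 1 else 0) * F n)"
    by (simp add: G_ginv[OF assms] flip: sum_distrib_right)
  finally show ?thesis by (simp add: if_distrib[of "\<lambda>z. z * _"] cong: if_cong)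
qed

lemma ginv_sym:
  assumes "x \<in> U"
  shows "ginv G x a b = ginv G x b a"
proof -
  have T: "transpose (G x) = G x"
    using G_sym[OF assms] by (simp add: transpose_def vec_eq_iff)
  note inv = matrix_inv_mult[OF G_invertible[OF assms]]
  let ?H = "matrix_inv (G x)"
  have "transpose ?H ** G x = transpose (G x ** ?H)"
    by (simp add: matrix_transpose_mul T)
  then have "transpose ?H ** G x = mat 1"
    by (simp add: inv(1) transpose_mat)
  then have "transpose ?H ** (G x ** ?H) = ?H"
    by (simp add: matrix_mul_assoc)
  then have "transpose ?H = ?H"
    by (simp add: inv(1))
  then have "transpose ?H $ a $ b = ?H $ a $ b" by simp
  then show ?thesis
    by (simp add: ginv_def transpose_def)
qed

lemma smooth_ginv: "smooth_on U (\<lambda>x. ginv G x a b)"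
  unfolding ginv_def using open_U smooth_G G_invertible by (rule smooth_on_matrix_inv)

lemma ctr_swap: "x \<in> U \<Longrightarrow> ctr G x (\<lambda>a b. T b a) = ctr G x T"
  unfolding ctr_def by (subst sum.swap) (simp add: ginv_sym)

lemma ctr_prod_commute: "x \<in> U \<Longrightarrow> ctr G x (\<lambda>a b. S a * T b) = ctr G x (\<lambda>a b. T a * S b)"
  using ctr_swap[of x "\<lambda>a b. S a * T b"] by (simp add: mult.commute)

text \<open>Contracting with the metric only renames an index. The four variants cover the positions
  of the contracted index and of the metric factor, so that \<open>ctr_metric\<close> works as a set
  of rewrite rules.\<close>

lemma ctr_G1:
  assumes "x \<in> U"
  shows "ctr G x (\<lambda>a b. G x $ b $ c * F a) = F c"
proof -
  have "ctr G x (\<lambda>a b. G x $ b $ c * F a) = (\<Sum>a\<in>UNIV. (\<Sum>b\<in>UNIV. ginv G x a b * G x $ b $ c) * F a)"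
    by (simp add: ctr_def sum_distrib_right mult.assoc)
  then show ?thesis
    by (simp add: ginv_G[OF assms] if_distrib[of "\<lambda>z. z * _"] cong: if_cong)
qed

lemma ctr_G2: "x \<in> U \<Longrightarrow> ctr G x (\<lambda>a b. G x $ c $ b * F a) = F c"
  using ctr_G1[of x c F] by (simp add: G_sym[of x c])

lemma ctr_G3: "x \<in> U \<Longrightarrow> ctr G x (\<lambda>a b. G x $ a $ c * F b) = F c"
  using ctr_G1[of x c F] ctr_swap[of x "\<lambda>a b. G x $ b $ c * F a"] by simp

lemma ctr_G4: "x \<in> U \<Longrightarrow> ctr G x (\<lambda>a b. G x $ c $ a * F b) = F c"
  using ctr_G3[of x c F] by (simp add: G_sym[of x c])

text \<open>The 4 is the dimension; it balances the terms in \<open>u\<close> in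
  \<open>box_\<omega>\<close>, \<open>div_weyl_H\<close> and \<open>ctr_cov_deriv_H\<close>.\<close>

lemma ctr_G: "x \<in> U \<Longrightarrow> ctr G x (\<lambda>a b. G x $ a $ b) = 4"
  using ginv_G[of x a a for a] by (simp add: ctr_def G_sym[of x])

lemmas ctr_metric = ctr_G1 ctr_G2 ctr_G3 ctr_G4 ctr_G

section \<open>Torsion freeness and metric compatibility\<close>

lemma partial_G_sym: "x \<in> U \<Longrightarrow> partial c (\<lambda>y. G y $ a $ b) x = partial c (\<lambda>y. G y $ b $ a) x"
  using G_sym by (intro partial_cong[OF open_U])

lemma christoffel1_sym: "x \<in> U \<Longrightarrow> christoffel1 G n a b x = christoffel1 G n b a x"
  by (simp add: christoffel1_def partial_G_sym[of x n a b])

lemma christoffel_sym: "x \<in> U \<Longrightarrow> christoffel G n a b x = christoffel G n b a x"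
  by (simp add: christoffel_eq_christoffel1 christoffel1_sym)

lemma conn_sym: "x \<in> U \<Longrightarrow> conn G x a b F = conn G x b a F"
  by (simp add: conn_def christoffel_sym[of x _ a b])

text \<open>Metric compatibility in first-kind form: in the sum of the two symbols all derivatives
  cancel except the one along \<open>e\<close>.\<close>

lemma partial_G:
  "x \<in> U \<Longrightarrow> partial e (\<lambda>y. G y $ a $ b) x = christoffel1 G a e b x + christoffel1 G b e a x"
  by (simp add: christoffel1_def partial_G_sym[of x e b a] partial_G_sym[of x a b e]
      partial_G_sym[of x b a e] field_simps)

lemma G_christoffel:
  "x \<in> U \<Longrightarrow> (\<Sum>m\<in>UNIV. G x $ a $ m * christoffel G m b c x) = christoffel1 G a b c x"
  by (simp add: christoffel_eq_christoffel1 G_ginv_contract)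

lemma conn_G: "x \<in> U \<Longrightarrow> conn G x e a (\<lambda>m. G x $ m $ b) = christoffel1 G b e a x"
  using G_christoffel[of x b e a] by (simp add: conn_def mult.commute G_sym[of x _ b])

lemma conn_G': "x \<in> U \<Longrightarrow> conn G x e a (\<lambda>m. G x $ b $ m) = christoffel1 G b e a x"
  using G_christoffel[of x b e a] by (simp add: conn_def mult.commute)

lemma partial_G_conn:
  "x \<in> U \<Longrightarrow> partial e (\<lambda>y. G y $ a $ b) x
     = conn G x e a (\<lambda>m. G x $ m $ b) + conn G x e b (\<lambda>m. G x $ a $ m)"
  by (simp add: conn_G conn_G' partial_G)

lemma partial_ginv:
  assumes x: "x \<in> U"
  shows "partial e (\<lambda>y. ginv G y a b) x
    = - ((\<Sum>m\<in>UNIV. christoffel G a e m x * ginv G x m b) + (\<Sum>m\<in>UNIV. christoffel G b e m x * ginv G x a m))"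
proof -
  have dG: "(\<lambda>y. G y $ m $ n) differentiable (at x)" for m n
    using smooth_on_differentiable[OF smooth_G x] .
  have dginv: "(\<lambda>y. ginv G y m n) differentiable (at x)" for m n
    using smooth_on_differentiable[OF smooth_ginv x] .
  \<comment> \<open>Differentiating the constant product of inverse and metric yields the derivative
    of the inverse contracted with the metric.\<close>
  have D: "(\<Sum>m\<in>UNIV. partial e (\<lambda>y. ginv G y a m) x * G x $ m $ n)
      = - (\<Sum>m\<in>UNIV. ginv G x a m * partial e (\<lambda>y. G y $ m $ n) x)" for n
  proof -
    have "partial e (\<lambda>y. \<Sum>m\<in>UNIV. ginv G y a m * G y $ m $ n) x
        = partial e (\<lambda>y. if a = n then 1 else 0) x"
      using ginv_G by (intro partial_cong[OF open_U x]) simp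
    also have "\<dots> = 0" by simp
    finally show ?thesis
      by (simp add: partial_sum partial_mult dG dginv differentiable_mult sum.distrib)
  qed
  \<comment> \<open>A Kronecker delta, written as metric times inverse, is inserted so that
    \<open>D\<close> applies.\<close>
  have "partial e (\<lambda>y. ginv G y a b) x
      = (\<Sum>m\<in>UNIV. partial e (\<lambda>y. ginv G y a m) x * (if m = b then 1 else 0))"
    by (simp add: if_distrib cong: if_cong)
  also have "\<dots> = (\<Sum>m\<in>UNIV. partial e (\<lambda>y. ginv G y a m) x * (\<Sum>n\<in>UNIV. G x $ m $ n * ginv G x n b))"
    by (simp add: G_ginv[OF x])
  also have "\<dots> = (\<Sum>m\<in>UNIV. \<Sum>n\<in>UNIV. partial e (\<lambda>y. ginv G y a m) x * G x $ m $ n * ginv G x n b)"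
    by (simp add: sum_distrib_left mult.assoc)
  also have "\<dots> = (\<Sum>n\<in>UNIV. \<Sum>m\<in>UNIV. partial e (\<lambda>y. ginv G y a m) x * G x $ m $ n * ginv G x n b)"
    by (rule sum.swap)
  also have "\<dots> = (\<Sum>n\<in>UNIV. - (\<Sum>m\<in>UNIV. ginv G x a m * partial e (\<lambda>y. G y $ m $ n) x) * ginv G x n b)"
    by (simp add: D flip: sum_distrib_right)
  also have "\<dots> = - (\<Sum>n\<in>UNIV. \<Sum>m\<in>UNIV. ginv G x a m * christoffel1 G m e n x * ginv G x n b)
      - (\<Sum>n\<in>UNIV. \<Sum>m\<in>UNIV. ginv G x a m * (ginv G x n b * christoffel1 G n e m x))"
    by (simp add: partial_G[OF x] sum_distrib_right distrib_left distrib_right sum.distrib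
        left_diff_distrib sum_subtractf sum_negf mult.assoc mult.commute[of "christoffel1 G _ e _ x"])
  also have "(\<Sum>n\<in>UNIV. \<Sum>m\<in>UNIV. ginv G x a m * (ginv G x n b * christoffel1 G n e m x))
      = (\<Sum>m\<in>UNIV. christoffel G b e m x * ginv G x a m)"
    by (subst sum.swap)
      (simp add: christoffel_eq_christoffel1 sum_distrib_left ginv_sym[OF x, of _ b]
        mult.commute[of _ "ginv G x a _"])
  also have "(\<Sum>n\<in>UNIV. \<Sum>m\<in>UNIV. ginv G x a m * christoffel1 G m e n x * ginv G x n b)
      = (\<Sum>m\<in>UNIV. christoffel G a e m x * ginv G x m b)"
    by (simp add: christoffel_eq_christoffel1 sum_distrib_right)
  finally show ?thesis by simp
qed

text \<open>As \<open>\<nabla>\<^sub>e g\<^sup>a\<^sup>b = 0\<close>, the covariant derivative commutes with contraction.\<close>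

lemma partial_ctr:
  assumes x: "x \<in> U" and T: "\<And>a b. (\<lambda>y. T y a b) differentiable (at x)"
  shows "partial e (\<lambda>y. ctr G y (T y)) x
    = ctr G x (\<lambda>a b. partial e (\<lambda>y. T y a b) x
        - (conn G x e a (\<lambda>m. T x m b) + conn G x e b (\<lambda>m. T x a m)))"
proof -
  have dginv: "(\<lambda>y. ginv G y m n) differentiable (at x)" for m n
    using smooth_on_differentiable[OF smooth_ginv x] .
  have 1: "partial e (\<lambda>y. ctr G y (T y)) x
    = (\<Sum>a\<in>UNIV. \<Sum>b\<in>UNIV. partial e (\<lambda>y. ginv G y a b) x * T x a b)
      + ctr G x (\<lambda>a b. partial e (\<lambda>y. T y a b) x)"
    unfolding ctr_def
    by (simp add: partial_sum partial_mult T dginv differentiable_mult differentiable_sum sum.distrib)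
  have 2: "(\<Sum>a\<in>UNIV. \<Sum>b\<in>UNIV. (\<Sum>m\<in>UNIV. christoffel G a e m x * ginv G x m b) * T x a b)
      = ctr G x (\<lambda>a b. conn G x e a (\<lambda>m. T x m b))"
  proof -
    have "(\<Sum>a\<in>UNIV. \<Sum>b\<in>UNIV. (\<Sum>m\<in>UNIV. christoffel G a e m x * ginv G x m b) * T x a b)
        = (\<Sum>a\<in>UNIV. \<Sum>b\<in>UNIV. \<Sum>m\<in>UNIV. ginv G x m b * (christoffel G a e m x * T x a b))"
      by (simp add: sum_distrib_right mult.left_commute mult.assoc)
    also have "\<dots> = (\<Sum>b\<in>UNIV. \<Sum>a\<in>UNIV. \<Sum>m\<in>UNIV. ginv G x m b * (christoffel G a e m x * T x a b))"
      by (rule sum.swap)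
    also have "\<dots> = (\<Sum>b\<in>UNIV. \<Sum>m\<in>UNIV. \<Sum>a\<in>UNIV. ginv G x m b * (christoffel G a e m x * T x a b))"
      by (intro sum.cong refl sum.swap)
    also have "\<dots> = (\<Sum>m\<in>UNIV. \<Sum>b\<in>UNIV. \<Sum>a\<in>UNIV. ginv G x m b * (christoffel G a e m x * T x a b))"
      by (rule sum.swap)
    finally show ?thesis by (simp add: ctr_def conn_def sum_distrib_left)
  qed
  have 3: "(\<Sum>a\<in>UNIV. \<Sum>b\<in>UNIV. (\<Sum>m\<in>UNIV. christoffel G b e m x * ginv G x a m) * T x a b)
      = ctr G x (\<lambda>a b. conn G x e b (\<lambda>m. T x a m))"
  proof -
    have "(\<Sum>a\<in>UNIV. \<Sum>b\<in>UNIV. (\<Sum>m\<in>UNIV. christoffel G b e m x * ginv G x a m) * T x a b)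
        = (\<Sum>a\<in>UNIV. \<Sum>b\<in>UNIV. \<Sum>m\<in>UNIV. ginv G x a m * (christoffel G b e m x * T x a b))"
      by (simp add: sum_distrib_right mult.left_commute mult.assoc)
    also have "\<dots> = (\<Sum>a\<in>UNIV. \<Sum>m\<in>UNIV. \<Sum>b\<in>UNIV. ginv G x a m * (christoffel G b e m x * T x a b))"
      by (intro sum.cong refl sum.swap)
    finally show ?thesis by (simp add: ctr_def conn_def sum_distrib_left)
  qed
  show ?thesis
    unfolding 1 partial_ginv[OF x] ctr_diff ctr_add 2[symmetric] 3[symmetric]
    by (simp add: distrib_right left_diff_distrib sum_negf sum_subtractf sum.distrib)
qed

subsection \<open>Smoothness of the curvature quantities\<close>

lemma smooth_christoffel: "smooth_on U (christoffel G c a b)"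
  unfolding christoffel_def[abs_def] using open_U smooth_G smooth_ginv
  by (intro smooth_on_intros) auto

lemma smooth_ctr: "(\<And>a b. smooth_on U (\<lambda>y. T y a b)) \<Longrightarrow> smooth_on U (\<lambda>y. ctr G y (T y))"
  unfolding ctr_def using open_U smooth_ginv by (intro smooth_on_intros) auto

lemma smooth_riemann_up: "smooth_on U (riemann_up G a b c d)"
  unfolding riemann_up_def[abs_def] using open_U smooth_christoffel
  by (intro smooth_on_intros) auto

lemma smooth_riemann: "smooth_on U (\<lambda>y. riemann G y a b c d)"
  unfolding riemann_def using open_U smooth_G smooth_riemann_up by (intro smooth_on_intros) auto

lemma smooth_ricci: "smooth_on U (\<lambda>y. ricci G y a b)"
  unfolding ricci_def using open_U smooth_riemann_up by (intro smooth_on_intros) auto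

lemma smooth_scalar_curv: "smooth_on U (\<lambda>y. scalar_curv G y)"
  unfolding scalar_curv_def using open_U smooth_ginv smooth_ricci
  by (intro smooth_on_intros) auto

lemma smooth_weyl: "smooth_on U (\<lambda>y. weyl G y a b c d)"
  unfolding weyl_def using open_U smooth_G smooth_riemann smooth_ricci smooth_scalar_curv
  by (intro smooth_on_intros) auto

lemma smooth_cov_deriv:
  assumes "\<And>idx. smooth_on U (\<lambda>y. T y idx)"
  shows "smooth_on U (\<lambda>y. cov_deriv G T y idx)"
proof (cases idx)
  case Nil
  then show ?thesis by (simp add: smooth_on_const)
next
  case (Cons e l)
  then show ?thesis
    using assms open_U smooth_christoffel unfolding Cons cov_deriv.simps
    by (intro smooth_on_intros) auto
qed

section \<open>Symmetries of the curvature\<close>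

lemma partial_G_commute:
  "x \<in> U \<Longrightarrow> partial c (partial b (\<lambda>y. G y $ p $ q)) x = partial b (partial c (\<lambda>y. G y $ p $ q)) x"
  using open_U smooth_G by (rule partial_commute_smooth)

lemma partial_partial_G_sym:
  "x \<in> U \<Longrightarrow> partial c (partial b (\<lambda>y. G y $ p $ q)) x = partial c (partial b (\<lambda>y. G y $ q $ p)) x"
  by (rule partial_cong[OF open_U]) (auto intro: partial_G_sym)

lemma partial_christoffel1:
  assumes x: "x \<in> U"
  shows "partial c (christoffel1 G a d b) x = (1/2) * (partial c (partial d (\<lambda>y. G y $ b $ a)) x
    + partial c (partial b (\<lambda>y. G y $ d $ a)) x - partial c (partial a (\<lambda>y. G y $ d $ b)) x)"
proof -
  have "partial k (\<lambda>y. G y $ p $ q) differentiable (at x)" for k p q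
    using smooth_on_differentiable[OF smooth_on_partial[OF smooth_G] x] .
  then show ?thesis
    unfolding christoffel1_def[abs_def]
    by (simp only: partial_cmult partial_add partial_diff differentiable_add differentiable_diff)
qed

text \<open>Product rule for \<open>G_christoffel\<close>: lowering an index does not commute with a
  partial derivative, and the defect, the derivative of the metric times a Christoffel symbol, is
  again a contraction of first-kind symbols.\<close>

lemma lower_partial_christoffel:
  assumes x: "x \<in> U"
  shows "(\<Sum>m\<in>UNIV. G x $ a $ m * partial c (christoffel G m d b) x)
    = partial c (christoffel1 G a d b) x
      - ctr G x (\<lambda>m n. (christoffel1 G m c a x + christoffel1 G a c m x) * christoffel1 G n d b x)"
proof -
  have dG: "(\<lambda>y. G y $ m $ n) differentiable (at x)" for m n
    using smooth_on_differentiable[OF smooth_G x] .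
  have dC: "christoffel G m d b differentiable (at x)" for m
    using smooth_on_differentiable[OF smooth_christoffel x] .
  have "partial c (christoffel1 G a d b) x
      = partial c (\<lambda>y. \<Sum>m\<in>UNIV. G y $ a $ m * christoffel G m d b y) x"
    by (intro partial_cong[OF open_U x]) (simp add: G_christoffel)
  also have "\<dots> = (\<Sum>m\<in>UNIV. partial c (\<lambda>y. G y $ a $ m) x * christoffel G m d b x)
      + (\<Sum>m\<in>UNIV. G x $ a $ m * partial c (christoffel G m d b) x)"
    by (simp add: partial_sum partial_mult dG dC differentiable_mult sum.distrib)
  also have "(\<Sum>m\<in>UNIV. partial c (\<lambda>y. G y $ a $ m) x * christoffel G m d b x)
      = ctr G x (\<lambda>m n. (christoffel1 G m c a x + christoffel1 G a c m x) * christoffel1 G n d b x)"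
    by (simp add: ctr_def christoffel_eq_christoffel1 partial_G[OF x] sum_distrib_left algebra_simps)
  finally show ?thesis by simp
qed

lemma lower_christoffel_christoffel:
  assumes x: "x \<in> U"
  shows "(\<Sum>m\<in>UNIV. G x $ a $ m * (\<Sum>e\<in>UNIV. christoffel G m c e x * christoffel G e d b x))
    = ctr G x (\<lambda>m n. christoffel1 G a c m x * christoffel1 G n d b x)"
proof -
  have "(\<Sum>m\<in>UNIV. G x $ a $ m * (\<Sum>e\<in>UNIV. christoffel G m c e x * christoffel G e d b x))
      = (\<Sum>e\<in>UNIV. \<Sum>m\<in>UNIV. G x $ a $ m * christoffel G m c e x * christoffel G e d b x)"
    by (subst sum.swap) (simp add: sum_distrib_left mult.assoc)
  also have "\<dots> = (\<Sum>e\<in>UNIV. christoffel1 G a c e x * christoffel G e d b x)"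
    by (simp add: G_christoffel[OF x] flip: sum_distrib_right)
  also have "\<dots> = ctr G x (\<lambda>m n. christoffel1 G a c m x * christoffel1 G n d b x)"
    by (simp add: ctr_def christoffel_eq_christoffel1[of G _ d b] sum_distrib_left mult.left_commute)
  finally show ?thesis .
qed

text \<open>The defect from lowering under the derivative cancels one half of the quadratic terms.
  What remains is linear in second derivatives of the metric plus two contractions, a form from
  which the symmetries and the effect of rescaling can both be read off.\<close>

lemma riemann_formula:
  assumes x: "x \<in> U"
  shows "riemann G x a b c d = (1/2) *
      (partial c (partial b (\<lambda>y. G y $ d $ a)) x - partial c (partial a (\<lambda>y. G y $ d $ b)) x
       - partial d (partial b (\<lambda>y. G y $ c $ a)) x + partial d (partial a (\<lambda>y. G y $ c $ b)) x)
     - ctr G x (\<lambda>m n. christoffel1 G m c a x * christoffel1 G n d b x)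
     + ctr G x (\<lambda>m n. christoffel1 G m d a x * christoffel1 G n c b x)"
proof -
  have "riemann G x a b c d =
      (\<Sum>m\<in>UNIV. G x $ a $ m * partial c (christoffel G m d b) x)
      - (\<Sum>m\<in>UNIV. G x $ a $ m * partial d (christoffel G m c b) x)
      + ((\<Sum>m\<in>UNIV. G x $ a $ m * (\<Sum>e\<in>UNIV. christoffel G m c e x * christoffel G e d b x))
      - (\<Sum>m\<in>UNIV. G x $ a $ m * (\<Sum>e\<in>UNIV. christoffel G m d e x * christoffel G e c b x)))"
    by (simp add: riemann_def riemann_up_def sum_subtractf sum.distrib right_diff_distrib distrib_left)
  then show ?thesis
    unfolding lower_partial_christoffel[OF x] lower_christoffel_christoffel[OF x]
      partial_christoffel1[OF x] distrib_right ctr_add partial_G_commute[OF x, of c d]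
    by (simp add: field_simps)
qed

lemma riemann_antisym2: "riemann G x a b d c = - riemann G x a b c d"
  by (simp add: riemann_def riemann_up_def sum_subtractf algebra_simps flip: sum_negf)

lemma riemann_antisym1:
  assumes x: "x \<in> U"
  shows "riemann G x b a c d = - riemann G x a b c d"
  unfolding riemann_formula[OF x]
    ctr_prod_commute[OF x, of "\<lambda>m. christoffel1 G m c b x"]
    ctr_prod_commute[OF x, of "\<lambda>m. christoffel1 G m d b x"]
  by (simp add: field_simps)

lemma riemann_pair_sym:
  assumes x: "x \<in> U"
  shows "riemann G x c d a b = riemann G x a b c d"
proof -
  note P = partial_G_commute[OF x] and S = partial_partial_G_sym[OF x] and C = christoffel1_sym[OF x]
  have "riemann G x c d a b = (1/2) *
      (partial d (partial a (\<lambda>y. G y $ c $ b)) x - partial c (partial a (\<lambda>y. G y $ d $ b)) x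
       - partial d (partial b (\<lambda>y. G y $ c $ a)) x + partial c (partial b (\<lambda>y. G y $ d $ a)) x)
     - ctr G x (\<lambda>m n. christoffel1 G m c a x * christoffel1 G n d b x)
     + ctr G x (\<lambda>m n. christoffel1 G m c b x * christoffel1 G n d a x)"
    unfolding riemann_formula[OF x, of c d a b]
    using P[of a d b c] P[of a c b d] P[of b d a c] P[of b c a d]
      S[of d a b c] S[of c a b d] S[of d b a c] S[of c b a d]
    by (simp only: C[of _ a c] C[of _ b d] C[of _ b c] C[of _ a d])
  then show ?thesis
    unfolding riemann_formula[OF x, of a b c d]
      ctr_prod_commute[OF x, of "\<lambda>m. christoffel1 G m c b x"]
    by (simp add: field_simps)
qed

lemma riemann_bianchi1:
  assumes x: "x \<in> U"
  shows "riemann G x a b c d + riemann G x a c d b + riemann G x a d b c = 0"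
proof -
  note P = partial_G_commute[OF x] and S = partial_partial_G_sym[OF x] and C = christoffel1_sym[OF x]
  show ?thesis
    unfolding riemann_formula[OF x] C[of _ b c] C[of _ d c] C[of _ b d]
    using P[of d c b a] S[of d a b c] P[of b c d a] S[of b a d c] P[of b d c a] S[of c a b d]
    by (simp add: field_simps)
qed

lemma raise_riemann:
  assumes "x \<in> U"
  shows "riemann_up G a b c d x = (\<Sum>n\<in>UNIV. ginv G x a n * riemann G x n b c d)"
proof -
  have "(\<Sum>n\<in>UNIV. ginv G x a n * riemann G x n b c d)
      = (\<Sum>n\<in>UNIV. \<Sum>e\<in>UNIV. ginv G x a n * G x $ n $ e * riemann_up G e b c d x)"
    by (simp add: riemann_def sum_distrib_left mult.assoc)
  also have "\<dots> = (\<Sum>e\<in>UNIV. \<Sum>n\<in>UNIV. ginv G x a n * G x $ n $ e * riemann_up G e b c d x)"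
    by (rule sum.swap)
  also have "\<dots> = (\<Sum>e\<in>UNIV. (if a = e then 1 else 0) * riemann_up G e b c d x)"
    by (simp add: ginv_G[OF assms] flip: sum_distrib_right)
  finally show ?thesis by (simp add: if_distrib[of "\<lambda>z. z * _"] cong: if_cong)
qed

lemma ricci_eq_ctr: "x \<in> U \<Longrightarrow> ricci G x b d = ctr G x (\<lambda>a c. riemann G x a b c d)"
  using ctr_swap[of x "\<lambda>a c. riemann G x a b c d"]
  by (simp add: ricci_def raise_riemann ctr_def)

lemma scalar_curv_eq_ctr: "scalar_curv G x = ctr G x (ricci G x)"
  by (simp add: scalar_curv_def ctr_def)

lemma ricci_sym: "x \<in> U \<Longrightarrow> ricci G x a b = ricci G x b a"
  using ctr_swap[of x "\<lambda>c d. riemann G x d b c a"]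
  by (simp add: ricci_eq_ctr riemann_pair_sym[of x _ a _ b])

end

text \<open>The algebraic symmetries of a Weyl tensor, as a predicate on arbitrary component arrays,
  because they are needed for each covariant derivative of the Weyl tensor as well.\<close>

definition weyl_like :: "(real^4 \<Rightarrow> real^4^4) \<Rightarrow> real^4 \<Rightarrow> (4 \<Rightarrow> 4 \<Rightarrow> 4 \<Rightarrow> 4 \<Rightarrow> real) \<Rightarrow> bool" where
  "weyl_like G x T \<longleftrightarrow> (\<forall>a b c d. T b a c d = - T a b c d \<and> T a b d c = - T a b c d \<and>
     T c d a b = T a b c d \<and> T a b c d + T a c d b + T a d b c = 0 \<and>
     ctr G x (\<lambda>a c. T a b c d) = 0)"

lemma weyl_likeD:
  assumes "weyl_like G x T"
  shows "T b a c d = - T a b c d" "T a b d c = - T a b c d" "T c d a b = T a b c d"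
    "T a b c d + T a c d b + T a d b c = 0" "ctr G x (\<lambda>a c. T a b c d) = 0"
  using assms unfolding weyl_like_def by blast+

context coord_metric
begin

lemma weyl_weyl_like:
  assumes x: "x \<in> U"
  shows "weyl_like G x (weyl G x)"
proof -
  note gs = G_sym[OF x] and rs = ricci_sym[OF x]
  have 1: "weyl G x b a c d = - weyl G x a b c d" for a b c d
    unfolding weyl_def riemann_antisym1[OF x, of b a] by (simp add: algebra_simps)
  have 2: "weyl G x a b d c = - weyl G x a b c d" for a b c d
    unfolding weyl_def riemann_antisym2[of x a b d c] by (simp add: algebra_simps)
  have 3: "weyl G x c d a b = weyl G x a b c d" for a b c d
    unfolding weyl_def riemann_pair_sym[OF x, of c d a b] gs[of c] gs[of d] rs[of c] rs[of d]
    by (simp add: algebra_simps)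
  have 4: "weyl G x a b c d + weyl G x a c d b + weyl G x a d b c = 0" for a b c d
    using riemann_bianchi1[OF x, of a b c d]
    unfolding weyl_def gs[of c b] gs[of d c] gs[of d b] rs[of c b] rs[of d c] rs[of d b]
    by (simp add: algebra_simps)
  \<comment> \<open>The coefficients 1/2 and 1/6 are adapted to dimension four: the Ricci terms have
    trace 2 Ric + R g, the scalar term has 3 R g, and Ric - (2 Ric + R g) / 2 + 3 R g / 6 =
    0.\<close>
  have 5: "ctr G x (\<lambda>a c. weyl G x a b c d) = 0" for b d
    unfolding weyl_def
    by (simp only: ctr_linear ctr_metric[OF x] ricci_eq_ctr[OF x, symmetric]
        scalar_curv_eq_ctr[symmetric]) (simp add: field_simps)
  show ?thesis unfolding weyl_like_def using 1 2 3 4 5 by blast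
qed

lemma weyl_tensor_Cons [simp]: "weyl_tensor G x [a, b, c, d] = weyl G x a b c d"
  by (simp add: weyl_tensor_def)

lemma smooth_weyl_tensor: "smooth_on U (\<lambda>y. weyl_tensor G y idx)"
  unfolding weyl_tensor_def by (rule smooth_weyl)

text \<open>Every symmetry is a linear relation between slot permutations or a metric trace, and
  covariant differentiation respects both.\<close>

lemma weyl_like_cov_deriv_weyl:
  assumes x: "x \<in> U"
  shows "weyl_like G x (\<lambda>a b c d. cov_deriv G (weyl_tensor G) x [e, a, b, c, d])"
proof -
  define W where "W = weyl G"
  have W: "W y b a c d = - W y a b c d" "W y a b d c = - W y a b c d" "W y c d a b = W y a b c d"
    "W y a b c d + W y a c d b + W y a d b c = 0" "ctr G y (\<lambda>a c. W y a b c d) = 0"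
    if "y \<in> U" for y a b c d
    using weyl_weyl_like[OF that] unfolding weyl_like_def W_def by blast+
  have dW: "(\<lambda>y. W y a b c d) differentiable (at x)" for a b c d
    unfolding W_def using smooth_on_differentiable[OF smooth_weyl x] .
  let ?E = "\<lambda>a b c d. partial e (\<lambda>y. W y a b c d) x
     - (conn G x e a (\<lambda>m. W x m b c d) + conn G x e b (\<lambda>m. W x a m c d)
        + conn G x e c (\<lambda>m. W x a b m d) + conn G x e d (\<lambda>m. W x a b c m))"
  have 1: "?E b a c d = - ?E a b c d" for a b c d
  proof -
    have "partial e (\<lambda>y. W y b a c d) x = partial e (\<lambda>y. - W y a b c d) x"
      using W(1)[of _ b a] by (intro partial_cong[OF open_U x]) auto
    then show ?thesis
      by (simp add: partial_minus dW W(1)[OF x, of b] W(1)[OF x, of _ a] conn_minus)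
  qed
  have 2: "?E a b d c = - ?E a b c d" for a b c d
  proof -
    have "partial e (\<lambda>y. W y a b d c) x = partial e (\<lambda>y. - W y a b c d) x"
      using W(2)[of _ a b d c] by (intro partial_cong[OF open_U x]) auto
    then show ?thesis
      by (simp add: partial_minus dW W(2)[OF x, of _ _ d] W(2)[OF x, of _ _ _ c] conn_minus)
  qed
  have 3: "?E c d a b = ?E a b c d" for a b c d
  proof -
    have "partial e (\<lambda>y. W y c d a b) x = partial e (\<lambda>y. W y a b c d) x"
      using W(3)[of _ c d a b] by (intro partial_cong[OF open_U x]) auto
    then show ?thesis
      by (simp add: W(3)[OF x, of c d] W(3)[OF x, of _ d] W(3)[OF x, of c _])
  qed
  have 4: "?E a b c d + ?E a c d b + ?E a d b c = 0" for a b c d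
  proof -
    have "partial e (\<lambda>y. W y a b c d + W y a c d b + W y a d b c) x = partial e (\<lambda>y. 0) x"
      using W(4) by (intro partial_cong[OF open_U x]) auto
    then have "partial e (\<lambda>y. W y a b c d) x + partial e (\<lambda>y. W y a c d b) x
        + partial e (\<lambda>y. W y a d b c) x = 0"
      by (simp add: partial_add dW)
    moreover have "conn G x e a (\<lambda>m. W x m b c d) + conn G x e a (\<lambda>m. W x m c d b)
        + conn G x e a (\<lambda>m. W x m d b c) = 0"
      by (simp add: W(4)[OF x] conn_zero flip: conn_add)
    moreover have "conn G x e p (\<lambda>m. W x a m q r) + conn G x e p (\<lambda>m. W x a q r m)
        + conn G x e p (\<lambda>m. W x a r m q) = 0" for p q r
      by (simp add: W(4)[OF x] conn_zero flip: conn_add)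
    note this[of b c d] this[of c d b] this[of d b c]
    ultimately show ?thesis by simp
  qed
  have 5: "ctr G x (\<lambda>a c. ?E a b c d) = 0" for b d
  proof -
    have "partial e (\<lambda>y. ctr G y (\<lambda>a c. W y a b c d)) x = partial e (\<lambda>y. 0) x"
      using W(5) by (intro partial_cong[OF open_U x]) auto
    \<comment> \<open>Connection terms in the two free slots vanish by tracing inside them; those in
      the contracted slots are absorbed by \<open>partial_ctr\<close>.\<close>
    moreover have "ctr G x (\<lambda>a c. conn G x e p (\<lambda>m. W x a m c q)) = 0" for p q
      by (simp add: W(5)[OF x] conn_zero flip: conn_ctr)
    moreover have "ctr G x (\<lambda>a c. conn G x e p (\<lambda>m. W x a q c m)) = 0" for p q
      by (simp add: W(5)[OF x] conn_zero flip: conn_ctr)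
    ultimately show ?thesis
      by (simp add: partial_ctr[OF x dW] ctr_linear)
  qed
  show ?thesis
    unfolding weyl_like_def cov_deriv4 weyl_tensor_Cons
    using 1 2 3 4 5 unfolding W_def by blast
qed

subsection \<open>The divergence of the Weyl tensor\<close>

text \<open>Metric compatibility for a tensor of rank five. The contracted slots are the first and
  the last, the places of the inner derivative index and of \<open>d\<close> in the Bach
  tensor.\<close>

lemma cov_deriv_ctr:
  assumes x: "x \<in> U" and T: "\<And>idx. smooth_on U (\<lambda>y. T y idx)"
  shows "ctr G x (\<lambda>d f. cov_deriv G T x [e, f, a, c, b, d])
    = cov_deriv G (\<lambda>y idx. ctr G y (\<lambda>d f. T y [f, idx ! 0, idx ! 1, idx ! 2, d])) x [e, a, c, b]"
proof -
  have dT: "(\<lambda>y. T y idx) differentiable (at x)" for idx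
    using smooth_on_differentiable[OF T x] .
  show ?thesis
    unfolding cov_deriv3 cov_deriv5
    by (simp add: partial_ctr[OF x dT] ctr_linear conn_ctr)
qed

text \<open>\<nabla>^d C_acbd with slots in the order a, c, b, a constant multiple of the Cotton
  tensor. The list argument makes it a valid input of \<open>cov_deriv\<close>.\<close>

definition div_weyl :: "real^4 \<Rightarrow> 4 list \<Rightarrow> real" where
  "div_weyl y idx = ctr G y (\<lambda>d f. cov_deriv G (weyl_tensor G) y [f, idx ! 0, idx ! 1, idx ! 2, d])"

lemma bach_eq_div_div:
  assumes x: "x \<in> U"
  shows "bach G x a b = ctr G x (\<lambda>c e. cov_deriv G div_weyl x [e, a, c, b])
    + (1/2) * ctr G x (\<lambda>c e. ctr G x (\<lambda>d f. ricci G x e f * weyl G x a c b d))"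
proof -
  have "bach G x a b = (\<Sum>c\<in>UNIV. \<Sum>e\<in>UNIV. \<Sum>d\<in>UNIV. \<Sum>f\<in>UNIV.
     ginv G x c e * ginv G x d f *
       (cov_deriv G (cov_deriv G (weyl_tensor G)) x [e, f, a, c, b, d]
        + (1/2) * ricci G x e f * weyl G x a c b d))"
    unfolding bach_def by (intro sum.cong refl sum.swap)
  also have "\<dots> = ctr G x (\<lambda>c e. ctr G x (\<lambda>d f.
       cov_deriv G (cov_deriv G (weyl_tensor G)) x [e, f, a, c, b, d]
        + (1/2) * ricci G x e f * weyl G x a c b d))"
    by (simp only: ctr_def sum_distrib_left mult.assoc)
  also have "\<dots> = ctr G x (\<lambda>c e. ctr G x (\<lambda>d f.
       cov_deriv G (cov_deriv G (weyl_tensor G)) x [e, f, a, c, b, d]))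
    + (1/2) * ctr G x (\<lambda>c e. ctr G x (\<lambda>d f. ricci G x e f * weyl G x a c b d))"
    by (simp only: ctr_add ctr_cmult mult.assoc)
  finally show ?thesis
    unfolding div_weyl_def cov_deriv_ctr[OF x smooth_cov_deriv[OF smooth_weyl_tensor]] .
qed

section \<open>Einstein metrics are Bach flat\<close>

lemma riemann_up_antisym2: "riemann_up G a b d c x = - riemann_up G a b c d x"
  by (simp add: riemann_up_def sum_subtractf)

text \<open>\<open>D\<close> omits the connection terms of the last two slots, so its cyclic sum is
  the exterior covariant derivative of the curvature two-form. The identity then reduces to
  commuting second derivatives of the Christoffel symbols.\<close>

lemma riemann_up_bianchi2:
  assumes x: "x \<in> U"
  defines "D \<equiv> \<lambda>a b e c d. partial e (riemann_up G a b c d) x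
      + (\<Sum>n\<in>UNIV. christoffel G a e n x * riemann_up G n b c d x)
      - conn G x e b (\<lambda>n. riemann_up G a n c d x)"
  shows "D a b e c d + D a b c d e + D a b d e c = 0"
proof -
  let ?\<Gamma> = "\<lambda>n p q. christoffel G n p q x" and ?d = "\<lambda>e n p q. partial e (christoffel G n p q) x"
  \<comment> \<open>Cubic terms enter \<open>D\<close> as \<open>T e c d - T c d e\<close> and
    \<open>T d c e - T e d c\<close>; both differences have vanishing cyclic sum. \<open>L\<close>
    collects the products of a symbol with a derivative.\<close>
  define T where "T e c d = (\<Sum>n\<in>UNIV. \<Sum>k\<in>UNIV. ?\<Gamma> a e n * (?\<Gamma> n c k * ?\<Gamma> k d b))" for e c d
  define L where "L e c d n = ?d e a c n * ?\<Gamma> n d b + ?\<Gamma> a c n * ?d e n d b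
      - (?d e a d n * ?\<Gamma> n c b + ?\<Gamma> a d n * ?d e n c b)
      + ?\<Gamma> a e n * (?d c n d b - ?d d n c b) - ?\<Gamma> n e b * (?d c a d n - ?d d a c n)" for e c d n
  have dC: "christoffel G n p q differentiable (at x)" for n p q
    using smooth_on_differentiable[OF smooth_christoffel x] .
  have dC2: "partial k (christoffel G n p q) differentiable (at x)" for k n p q
    using smooth_on_differentiable[OF smooth_on_partial[OF smooth_christoffel] x] .
  have dR: "partial e (riemann_up G a b c d) x = partial e (partial c (christoffel G a d b)) x
      - partial e (partial d (christoffel G a c b)) x
      + (\<Sum>n\<in>UNIV. ?d e a c n * ?\<Gamma> n d b + ?\<Gamma> a c n * ?d e n d b
        - (?d e a d n * ?\<Gamma> n c b + ?\<Gamma> a d n * ?d e n c b))" for e c d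
    unfolding riemann_up_def[abs_def]
    by (simp add: partial_add partial_diff partial_mult partial_sum dC dC2 differentiable_mult
        differentiable_diff differentiable_add differentiable_sum)
  have up: "(\<Sum>n\<in>UNIV. ?\<Gamma> a e n * riemann_up G n b c d x)
      = (\<Sum>n\<in>UNIV. ?\<Gamma> a e n * (?d c n d b - ?d d n c b)) + T e c d - T e d c" for e c d
    by (simp add: riemann_up_def T_def sum_distrib_left sum.distrib sum_subtractf distrib_left
        right_diff_distrib)
  have sw: "(\<Sum>n\<in>UNIV. \<Sum>k\<in>UNIV. ?\<Gamma> n e b * (?\<Gamma> a c k * ?\<Gamma> k d n)) = T c d e" for e c d
    unfolding T_def by (subst sum.swap) (simp add: mult_ac)
  have dn: "conn G x e b (\<lambda>n. riemann_up G a n c d x)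
      = (\<Sum>n\<in>UNIV. ?\<Gamma> n e b * (?d c a d n - ?d d a c n)) + T c d e - T d c e" for e c d
    by (simp add: riemann_up_def conn_def sum_distrib_left sum.distrib sum_subtractf distrib_left
        right_diff_distrib flip: sw)
  have D: "D a b e c d = partial e (partial c (christoffel G a d b)) x
      - partial e (partial d (christoffel G a c b)) x
      + (\<Sum>n\<in>UNIV. L e c d n) + T e c d - T e d c - T c d e + T d c e" for e c d
    unfolding D_def dR up dn L_def by (simp add: sum.distrib sum_subtractf)
  have "(\<Sum>n\<in>UNIV. L e c d n) + (\<Sum>n\<in>UNIV. L c d e n) + (\<Sum>n\<in>UNIV. L d e c n)
      = (\<Sum>n\<in>UNIV. L e c d n + L c d e n + L d e c n)"
    by (simp add: sum.distrib)
  \<comment> \<open>These products cancel for each value of the summation index separately.\<close>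
  also have "\<dots> = (\<Sum>n\<in>(UNIV::4 set). 0)"
    by (intro sum.cong refl) (simp add: L_def algebra_simps)
  finally have L: "(\<Sum>n\<in>UNIV. L e c d n) + (\<Sum>n\<in>UNIV. L c d e n) + (\<Sum>n\<in>UNIV. L d e c n) = 0"
    by simp
  have C: "partial j (partial i (christoffel G n p q)) x = partial i (partial j (christoffel G n p q)) x"
    for i j n p q
    using partial_commute_smooth[OF open_U smooth_christoffel x] .
  show ?thesis
    unfolding D using L C[of e c a d b] C[of e d a c b] C[of c d a e b] by simp
qed

definition riemann_tensor :: "real^4 \<Rightarrow> 4 list \<Rightarrow> real" where
  "riemann_tensor y idx = riemann G y (idx ! 0) (idx ! 1) (idx ! 2) (idx ! 3)"

lemma riemann_tensor_Cons [simp]: "riemann_tensor x [a, b, c, d] = riemann G x a b c d"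
  by (simp add: riemann_tensor_def)

text \<open>The metric is parallel: one half of its derivative cancels the connection term of slot
  \<open>a\<close>, the other half becomes the connection term of the upper index.\<close>

lemma cov_deriv_riemann_lower:
  assumes x: "x \<in> U"
  shows "cov_deriv G riemann_tensor x [e, a, b, c, d]
    = (\<Sum>m\<in>UNIV. G x $ a $ m * (partial e (riemann_up G m b c d) x
      + (\<Sum>n\<in>UNIV. christoffel G m e n x * riemann_up G n b c d x)
      - conn G x e b (\<lambda>n. riemann_up G m n c d x)
      - conn G x e c (\<lambda>n. riemann_up G m b n d x) - conn G x e d (\<lambda>n. riemann_up G m b c n x)))"
proof -
  have dG: "(\<lambda>y. G y $ m $ n) differentiable (at x)" for m n
    using smooth_on_differentiable[OF smooth_G x] .
  have dR: "riemann_up G m b c d differentiable (at x)" for m b c d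
    using smooth_on_differentiable[OF smooth_riemann_up x] .
  have 1: "partial e (\<lambda>y. riemann G y a b c d) x
      = (\<Sum>m\<in>UNIV. conn G x e a (\<lambda>k. G x $ k $ m) * riemann_up G m b c d x)
      + (\<Sum>m\<in>UNIV. conn G x e m (\<lambda>k. G x $ a $ k) * riemann_up G m b c d x)
      + (\<Sum>m\<in>UNIV. G x $ a $ m * partial e (riemann_up G m b c d) x)"
    unfolding riemann_def
    by (simp add: partial_sum partial_mult dG dR differentiable_mult partial_G_conn[OF x]
        distrib_right sum.distrib)
  have 2: "(\<Sum>m\<in>UNIV. conn G x e m (\<lambda>k. G x $ a $ k) * riemann_up G m b c d x)
      = (\<Sum>m\<in>UNIV. G x $ a $ m * (\<Sum>n\<in>UNIV. christoffel G m e n x * riemann_up G n b c d x))"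
    unfolding conn_def sum_distrib_left sum_distrib_right
    by (subst sum.swap) (simp add: mult_ac)
  have 3: "conn G x e p (\<lambda>k. \<Sum>m\<in>UNIV. F m k) = (\<Sum>m\<in>UNIV. conn G x e p (F m))" for p and F :: "4 \<Rightarrow> 4 \<Rightarrow> real"
    unfolding conn_def sum_distrib_left by (rule sum.swap)
  show ?thesis
    unfolding cov_deriv4 riemann_tensor_Cons 1 2
    by (simp add: riemann_def 3 conn_cmult conn_multc distrib_left right_diff_distrib sum.distrib
        sum_subtractf)
qed

lemma riemann_bianchi2:
  assumes x: "x \<in> U"
  shows "cov_deriv G riemann_tensor x [e, a, b, c, d] + cov_deriv G riemann_tensor x [c, a, b, d, e]
    + cov_deriv G riemann_tensor x [d, a, b, e, c] = 0"
proof -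
  \<comment> \<open>Torsion freeness and antisymmetry of the last pair: in the cyclic sum the
    connection terms omitted from \<open>D\<close> cancel in pairs.\<close>
  have neg: "conn G x p q (\<lambda>n. riemann_up G m b r n x) = - conn G x q p (\<lambda>n. riemann_up G m b n r x)"
    for p q r m
    by (simp add: riemann_up_antisym2[of m b r] conn_minus conn_sym[OF x, of p q])
  show ?thesis
    unfolding cov_deriv_riemann_lower[OF x] sum.distrib[symmetric] distrib_left[symmetric]
    using riemann_up_bianchi2[OF x, where b = b and e = e and c = c and d = d]
    by (intro sum.neutral ballI) (simp add: neg algebra_simps)
qed

section \<open>Traces and the contracted Bianchi identity\<close>

lemma ctr_antisym:
  assumes "x \<in> U" "\<And>a b. T b a = - T a b"
  shows "ctr G x (\<lambda>a b. T a b) = 0"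
proof -
  have "(\<lambda>a b. T b a) = (\<lambda>a b. - T a b)"
    by (intro ext assms(2))
  then show ?thesis
    using ctr_swap[OF assms(1), of T] by (simp add: ctr_minus)
qed

text \<open>The symmetries reduce every trace to the one over the first and third slots, or to zero
  by antisymmetry. The listed forms are those in which later contractions arise.\<close>

lemma weyl_like_trace:
  assumes x: "x \<in> U" and "weyl_like G x T"
  shows "ctr G x (\<lambda>b d. T a b c d) = 0" "ctr G x (\<lambda>d b. T a b c d) = 0"
    "ctr G x (\<lambda>b c. T a b c d) = 0" "ctr G x (\<lambda>d a. T a b c d) = 0"
    "ctr G x (\<lambda>d c. T a b c d) = 0"
proof -
  note T = weyl_likeD[OF assms(2)]
  have 13: "T a b c d = T b a d c" for a b c d
    using T(1)[of a b d c] T(2)[of a b d c] by simp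
  show 24: "ctr G x (\<lambda>b d. T a b c d) = 0" for a c
    unfolding 13[of a _ c] by (rule T(5))
  show "ctr G x (\<lambda>d b. T a b c d) = 0"
    using 24[of a c] ctr_swap[OF x, of "\<lambda>b d. T a b c d"] by simp
  show "ctr G x (\<lambda>b c. T a b c d) = 0"
    unfolding T(2)[of _ _ _ d] ctr_minus 24 by simp
  show "ctr G x (\<lambda>d a. T a b c d) = 0"
    using T(5)[of b c] ctr_swap[OF x, of "\<lambda>a d. T a b d c"]
    unfolding T(2)[of _ b c] ctr_minus by simp
  show "ctr G x (\<lambda>d c. T a b c d) = 0"
    by (rule ctr_antisym[OF x]) (rule T(2))
qed

lemma cov_deriv_riemann_pair_sym:
  assumes x: "x \<in> U"
  shows "cov_deriv G riemann_tensor x [e, c, d, a, b] = cov_deriv G riemann_tensor x [e, a, b, c, d]"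
proof -
  have "partial e (\<lambda>y. riemann G y c d a b) x = partial e (\<lambda>y. riemann G y a b c d) x"
    by (intro partial_cong[OF open_U x]) (rule riemann_pair_sym)
  then show ?thesis
    unfolding cov_deriv4 riemann_tensor_Cons
    by (simp add: riemann_pair_sym[OF x, of c d] riemann_pair_sym[OF x, of _ d]
        riemann_pair_sym[OF x, of c _])
qed

lemma ctr_cov_deriv_riemann:
  assumes x: "x \<in> U"
  shows "ctr G x (\<lambda>d f. cov_deriv G riemann_tensor x [e, b, d, c, f])
    = cov_deriv G (\<lambda>y idx. ricci G y (idx ! 0) (idx ! 1)) x [e, b, c]"
proof -
  have dR: "(\<lambda>y. riemann G y b d c f) differentiable (at x)" for b d c f
    using smooth_on_differentiable[OF smooth_riemann x] .
  have ric: "ctr G y (\<lambda>d f. riemann G y b d c f) = ricci G y b c" if "y \<in> U" for y b c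
    using that riemann_antisym1[OF that, of b] riemann_antisym2[of y _ b c]
    by (simp add: ricci_eq_ctr)
  have "partial e (\<lambda>y. ricci G y b c) x = partial e (\<lambda>y. ctr G y (\<lambda>d f. riemann G y b d c f)) x"
    using ric by (intro partial_cong[OF open_U x]) simp
  then show ?thesis
    unfolding cov_deriv4 cov_deriv2 riemann_tensor_Cons
    by (simp add: partial_ctr[OF x dR] ctr_linear ric[OF x] flip: conn_ctr)
qed

text \<open>The contracted Bianchi identity makes the Riemann tensor of an Einstein metric divergence
  free, and it differs from the Weyl tensor by a parallel tensor.\<close>

lemma einstein_bach_zero:
  assumes ein: "\<And>y a b. y \<in> U \<Longrightarrow> ricci G y a b = k * G y $ a $ b" and x: "x \<in> U"
  shows "bach G x a b = 0"
proof -
  have scal: "scalar_curv G y = 4 * k" if "y \<in> U" for y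
  proof -
    have "ricci G y = (\<lambda>a b. k * G y $ a $ b)"
      using ein[OF that] by (simp add: fun_eq_iff)
    then show ?thesis
      by (simp add: scalar_curv_eq_ctr ctr_cmult ctr_G[OF that])
  qed
  \<comment> \<open>With Ricci tensor \<open>k\<close> times the metric and scalar curvature
    \<open>4 * k\<close>, the Ricci part contributes \<open>k\<close> and the scalar part takes back
    \<open>4 * k / 6\<close>, leaving \<open>k / 3\<close>.\<close>
  have weyl: "weyl G y a b c d = riemann G y a b c d
      - k / 3 * (G y $ a $ c * G y $ b $ d - G y $ a $ d * G y $ b $ c)" if "y \<in> U" for y a b c d
    unfolding weyl_def scal[OF that] ein[OF that] by (simp add: field_simps)
  have cov_weyl: "cov_deriv G (weyl_tensor G) y [f, a, b, c, d] = cov_deriv G riemann_tensor y [f, a, b, c, d]"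
    if y: "y \<in> U" for y f a b c d
  proof -
    have dG: "(\<lambda>y. G y $ m $ n) differentiable (at y)" for m n
      using smooth_on_differentiable[OF smooth_G y] .
    have dR: "(\<lambda>y. riemann G y b d c f) differentiable (at y)" for b d c f
      using smooth_on_differentiable[OF smooth_riemann y] .
    have "partial f (\<lambda>y. weyl G y a b c d) y = partial f (\<lambda>y. riemann G y a b c d
      - k / 3 * (G y $ a $ c * G y $ b $ d - G y $ a $ d * G y $ b $ c)) y"
      using weyl by (intro partial_cong[OF open_U y]) simp
    also have "\<dots> = partial f (\<lambda>y. riemann G y a b c d) y
      - k / 3 * (partial f (\<lambda>y. G y $ a $ c) y * G y $ b $ d + G y $ a $ c * partial f (\<lambda>y. G y $ b $ d) y
        - (partial f (\<lambda>y. G y $ a $ d) y * G y $ b $ c + G y $ a $ d * partial f (\<lambda>y. G y $ b $ c) y))"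
      by (simp add: partial_diff partial_cmult partial_mult dG dR differentiable_mult differentiable_diff
          del: times_divide_eq_left)
    finally show ?thesis
      unfolding cov_deriv4 riemann_tensor_Cons weyl_tensor_Cons partial_G_conn[OF y] weyl[OF y]
      by (simp add: conn_linear algebra_simps del: times_divide_eq_left)
  qed
  have cov_ricci: "cov_deriv G (\<lambda>y idx. ricci G y (idx ! 0) (idx ! 1)) y [e, p, q] = 0"
    if y: "y \<in> U" for y e p q
  proof -
    have dG: "(\<lambda>y. G y $ m $ n) differentiable (at y)" for m n
      using smooth_on_differentiable[OF smooth_G y] .
    have "partial e (\<lambda>y. ricci G y p q) y = partial e (\<lambda>y. k * G y $ p $ q) y"
      using ein by (intro partial_cong[OF open_U y]) simp
    then show ?thesis
      unfolding cov_deriv2 by (simp add: ein[OF y] partial_cmult dG partial_G_conn[OF y] conn_cmult algebra_simps)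
  qed
  have div0: "ctr G y (\<lambda>d f. cov_deriv G (weyl_tensor G) y [f, a, c, b, d]) = 0"
    if y: "y \<in> U" for y a c b
  proof -
    have neg: "cov_deriv G riemann_tensor y [c, b, d, f, a] = - cov_deriv G riemann_tensor y [c, b, d, a, f]"
      for d f
    proof -
      have dR: "(\<lambda>y. riemann G y b d c f) differentiable (at y)" for b d c f
        using smooth_on_differentiable[OF smooth_riemann y] .
      show ?thesis
        unfolding cov_deriv4 riemann_tensor_Cons riemann_antisym2[of _ _ _ f a]
          riemann_antisym2[of _ _ _ f] riemann_antisym2[of _ _ _ _ a]
        by (simp add: partial_minus dR conn_minus)
    qed
    \<comment> \<open>Pair symmetry places \<open>a\<close>, \<open>c\<close> last, so that the
      second Bianchi identity, cyclic in \<open>f\<close>, \<open>a\<close>, \<open>c\<close>, turns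
      the divergence into a difference of two derivatives of the Ricci tensor.\<close>
    have "ctr G y (\<lambda>d f. cov_deriv G (weyl_tensor G) y [f, a, c, b, d])
        = ctr G y (\<lambda>d f. cov_deriv G riemann_tensor y [f, b, d, a, c])"
      by (simp only: cov_weyl[OF y] cov_deriv_riemann_pair_sym[OF y, of _ a c])
    also have "\<dots> = ctr G y (\<lambda>d f. cov_deriv G riemann_tensor y [c, b, d, a, f]
        - cov_deriv G riemann_tensor y [a, b, d, c, f])"
    proof -
      have "cov_deriv G riemann_tensor y [f, b, d, a, c]
          = cov_deriv G riemann_tensor y [c, b, d, a, f] - cov_deriv G riemann_tensor y [a, b, d, c, f]" for d f
        using riemann_bianchi2[OF y, of f b d a c] neg[of d f] by linarith
      then show ?thesis by simp
    qed
    also have "\<dots> = 0"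
      by (simp only: ctr_diff ctr_cov_deriv_riemann[OF y] cov_ricci[OF y])
    finally show ?thesis .
  qed
  have "cov_deriv G div_weyl x [e, a, c, b] = cov_deriv G (\<lambda>y idx. 0) x [e, a, c, b]" for e c
    by (rule cov_deriv_cong[OF open_U x]) (simp only: div_weyl_def div0)
  then have 1: "cov_deriv G div_weyl x [e, a, c, b] = 0" for e c
    by simp
  \<comment> \<open>For an Einstein metric the Ricci term of the Bach tensor is a multiple of a
    trace of the Weyl tensor.\<close>
  have "ctr G x (\<lambda>c e. weyl G x a c b e) = 0"
    by (rule weyl_like_trace(1)[OF x weyl_weyl_like[OF x]])
  then have 2: "ctr G x (\<lambda>c e. ctr G x (\<lambda>d f. ricci G x e f * weyl G x a c b d)) = 0"
    by (simp add: ein[OF x] mult.assoc ctr_cmult ctr_G2[OF x])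
  show ?thesis
    unfolding bach_eq_div_div[OF x] 1 2 by (simp add: ctr_zero)
qed

end

section \<open>Conformal changes\<close>

locale conformal_change = coord_metric +
  fixes \<omega> :: "real^4 \<Rightarrow> real"
  assumes smooth_\<omega>: "smooth_on U \<omega>" and \<omega>_nonzero: "\<And>x. x \<in> U \<Longrightarrow> \<omega> x \<noteq> 0"
begin

definition H :: "real^4 \<Rightarrow> real^4^4" where
  "H x = (\<omega> x)\<^sup>2 *\<^sub>R G x"

text \<open>\<open>u a\<close> is \<open>\<partial>\<^sub>a ln |\<omega>|\<close>.\<close>

definition u :: "4 \<Rightarrow> real^4 \<Rightarrow> real" where
  "u a x = partial a \<omega> x / \<omega> x"

definition norm_u :: "real^4 \<Rightarrow> real" where
  "norm_u x = ctr G x (\<lambda>m n. u m x * u n x)"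

definition hess_u :: "real^4 \<Rightarrow> 4 \<Rightarrow> 4 \<Rightarrow> real" where
  "hess_u x a b = partial a (u b) x - conn G x a b (\<lambda>m. u m x)"

text \<open>The amount by which rescaling lowers the Schouten tensor.\<close>

definition S :: "real^4 \<Rightarrow> 4 \<Rightarrow> 4 \<Rightarrow> real" where
  "S x a b = hess_u x a b - u a x * u b x + (1/2) * (norm_u x * G x $ a $ b)"

lemma H_nth: "H x $ a $ b = (\<omega> x * \<omega> x) * G x $ a $ b"
  by (simp add: H_def power2_eq_square)

lemma smooth_u: "smooth_on U (u a)"
  unfolding u_def[abs_def] using open_U smooth_\<omega> \<omega>_nonzero
  by (intro smooth_on_divide smooth_on_partial)

lemma partial_\<omega>: "x \<in> U \<Longrightarrow> partial a \<omega> x = \<omega> x * u a x"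
  using \<omega>_nonzero by (simp add: u_def)

text \<open>\<open>u\<close> is closed. Expanding the second partials of \<open>\<omega>\<close>
  itself shows this for either sign of \<open>\<omega>\<close>, without a logarithm.\<close>

lemma partial_u_sym:
  assumes x: "x \<in> U"
  shows "partial a (u b) x = partial b (u a) x"
proof -
  have d: "\<omega> differentiable (at x)" "u b differentiable (at x)" for b
    using smooth_on_differentiable[OF smooth_\<omega> x] smooth_on_differentiable[OF smooth_u x] by auto
  have P: "partial a (partial b \<omega>) x = \<omega> x * u a x * u b x + \<omega> x * partial a (u b) x" for a b
  proof -
    have "partial a (partial b \<omega>) x = partial a (\<lambda>y. \<omega> y * u b y) x"
      using partial_\<omega> by (intro partial_cong[OF open_U x]) simp
    then show ?thesis by (simp add: partial_mult d partial_\<omega>[OF x])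
  qed
  have "\<omega> x * u a x * u b x + \<omega> x * partial a (u b) x = \<omega> x * u b x * u a x + \<omega> x * partial b (u a) x"
    using partial_commute_smooth[OF open_U smooth_\<omega> x, of a b] unfolding P by simp
  then have "\<omega> x * partial a (u b) x = \<omega> x * partial b (u a) x" by simp
  then show ?thesis using \<omega>_nonzero[OF x] by simp
qed

section \<open>Inverse metric and connection after rescaling\<close>

lemma H_right_inverse:
  assumes x: "x \<in> U"
  shows "H x ** ((1 / (\<omega> x)\<^sup>2) *\<^sub>R matrix_inv (G x)) = mat 1"
proof -
  have "(H x ** ((1 / (\<omega> x)\<^sup>2) *\<^sub>R matrix_inv (G x))) $ i $ j = (G x ** matrix_inv (G x)) $ i $ j" for i j
    using \<omega>_nonzero[OF x] by (simp add: H_def matrix_matrix_mult_def)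
  then show ?thesis
    by (simp add: vec_eq_iff matrix_inv_mult(1)[OF G_invertible[OF x]])
qed

lemma invertible_H: "x \<in> U \<Longrightarrow> invertible (H x)"
  using H_right_inverse invertible_right_inverse by blast

lemma ginv_H:
  assumes x: "x \<in> U"
  shows "ginv H x a b = ginv G x a b / (\<omega> x * \<omega> x)"
proof -
  let ?K = "(1 / (\<omega> x)\<^sup>2) *\<^sub>R matrix_inv (G x)"
  have "matrix_inv (H x) ** (H x ** ?K) = matrix_inv (H x)"
    unfolding H_right_inverse[OF x] by simp
  then have "matrix_inv (H x) = ?K"
    by (simp only: matrix_mul_assoc matrix_inv_mult(2)[OF invertible_H[OF x]] matrix_mul_lid)
  then show ?thesis by (simp add: ginv_def power2_eq_square)
qed

lemma ctr_H: "x \<in> U \<Longrightarrow> ctr H x T = ctr G x T / (\<omega> x * \<omega> x)"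
  by (simp add: ctr_def ginv_H sum_divide_distrib)

sublocale H: coord_metric U H
proof
  show "smooth_on U (\<lambda>x. H x $ a $ b)" for a b
    unfolding H_nth using open_U smooth_\<omega> smooth_G by (intro smooth_on_mult)
qed (use open_U invertible_H G_sym in \<open>auto simp: H_nth\<close>)

lemma differentiable_G: "x \<in> U \<Longrightarrow> (\<lambda>y. G y $ a $ b) differentiable (at x)"
  using smooth_on_differentiable[OF smooth_G] .

lemma differentiable_\<omega>: "x \<in> U \<Longrightarrow> \<omega> differentiable (at x)"
  using smooth_on_differentiable[OF smooth_\<omega>] .

lemma differentiable_u: "x \<in> U \<Longrightarrow> u a differentiable (at x)"
  using smooth_on_differentiable[OF smooth_u] .

text \<open>Differentiation preserves the shape "\<omega>^2 times an expression in \<open>G\<close>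
  and \<open>u\<close>" in which the components of \<open>H\<close> are kept.\<close>

lemma partial_scaled:
  assumes "x \<in> U" "f differentiable (at x)"
  shows "partial e (\<lambda>y. (\<omega> y * \<omega> y) * f y) x = (\<omega> x * \<omega> x) * (2 * u e x * f x + partial e f x)"
  using assms
  by (simp add: partial_mult differentiable_\<omega> differentiable_mult partial_\<omega> algebra_simps)

lemma partial_H:
  "x \<in> U \<Longrightarrow> partial e (\<lambda>y. H y $ a $ b) x
     = (\<omega> x * \<omega> x) * (2 * u e x * G x $ a $ b + partial e (\<lambda>y. G y $ a $ b) x)"
  unfolding H_nth by (simp only: partial_scaled differentiable_G)

lemma partial_partial_H:
  assumes x: "x \<in> U"
  shows "partial c (partial e (\<lambda>y. H y $ a $ b)) x = (\<omega> x * \<omega> x) *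
      (partial c (partial e (\<lambda>y. G y $ a $ b)) x + 2 * u c x * partial e (\<lambda>y. G y $ a $ b) x
       + 2 * u e x * partial c (\<lambda>y. G y $ a $ b) x
       + (4 * u c x * u e x + 2 * partial c (u e) x) * G x $ a $ b)"
proof -
  have d: "partial e (\<lambda>y. G y $ a $ b) differentiable (at x)"
    using smooth_on_differentiable[OF smooth_on_partial[OF smooth_G] x] .
  note ds = differentiable_G[OF x] differentiable_u[OF x] d
  have "partial c (partial e (\<lambda>y. H y $ a $ b)) x
      = partial c (\<lambda>y. (\<omega> y * \<omega> y) * (2 * (u e y * G y $ a $ b) + partial e (\<lambda>y. G y $ a $ b) y)) x"
    by (intro partial_cong[OF open_U x]) (simp add: partial_H)
  also have "\<dots> = (\<omega> x * \<omega> x) * (2 * u c x * (2 * (u e x * G x $ a $ b) + partial e (\<lambda>y. G y $ a $ b) x)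
      + (2 * (partial c (u e) x * G x $ a $ b + u e x * partial c (\<lambda>y. G y $ a $ b) x)
        + partial c (partial e (\<lambda>y. G y $ a $ b)) x))"
    by (simp add: partial_scaled[OF x] partial_add partial_cmult partial_mult ds differentiable_add
        differentiable_mult del: distrib_left)
  finally show ?thesis by (simp add: algebra_simps)
qed

lemma christoffel1_H:
  "x \<in> U \<Longrightarrow> christoffel1 H n a b x = (\<omega> x * \<omega> x) *
     (christoffel1 G n a b x + u a x * G x $ b $ n + u b x * G x $ a $ n - u n x * G x $ a $ b)"
  unfolding christoffel1_def partial_H by (simp add: field_simps)

text \<open>The square of \<open>\<omega>\<close> in the first-kind symbol cancels against the
  inverse metric, leaving the difference tensor of the two Levi-Civita connections.\<close>

lemma conn_H:
  assumes x: "x \<in> U"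
  shows "conn H x e a F = conn G x e a F + u e x * F a + u a x * F e
    - G x $ e $ a * ctr G x (\<lambda>m n. u n x * F m)"
proof -
  have "(\<lambda>m n. christoffel1 H n e a x * F m)
      = (\<lambda>m n. (\<omega> x * \<omega> x) * (christoffel1 G n e a x * F m + u e x * (G x $ a $ n * F m)
      + u a x * (G x $ e $ n * F m) - G x $ e $ a * (u n x * F m)))"
    by (simp add: fun_eq_iff christoffel1_H[OF x] algebra_simps)
  then have "conn H x e a F = ctr G x (\<lambda>m n. christoffel1 G n e a x * F m + u e x * (G x $ a $ n * F m)
      + u a x * (G x $ e $ n * F m) - G x $ e $ a * (u n x * F m))"
    using \<omega>_nonzero[OF x] by (simp add: conn_eq_ctr ctr_H[OF x] ctr_cmult)
  then show ?thesis
    by (simp add: ctr_linear ctr_metric[OF x] conn_eq_ctr)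
qed

text \<open>The left factor has the shape given by \<open>christoffel1_H\<close>, the right one is
  arbitrary, so a product of two rescaled symbols can be expanded one factor at a time.\<close>

lemma ctr_conformal_left:
  assumes x: "x \<in> U"
  shows "ctr G x (\<lambda>m n. (L m + p * G x $ a $ m + q * G x $ c $ m - u m x * r) * Q n)
    = ctr G x (\<lambda>m n. L m * Q n) + p * Q a + q * Q c - r * ctr G x (\<lambda>m n. u m x * Q n)"
proof -
  have "(\<lambda>m n. (L m + p * G x $ a $ m + q * G x $ c $ m - u m x * r) * Q n)
      = (\<lambda>m n. L m * Q n + p * (G x $ a $ m * Q n) + q * (G x $ c $ m * Q n) - r * (u m x * Q n))"
    by (simp add: fun_eq_iff algebra_simps)
  then show ?thesis by (simp only: ctr_linear ctr_metric[OF x])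
qed

lemma christoffel1_product_H:
  assumes x: "x \<in> U"
  defines "\<Gamma> \<equiv> \<lambda>n a b. christoffel1 G n a b x" and "g \<equiv> \<lambda>a b. G x $ a $ b" and "v \<equiv> \<lambda>a. u a x"
    and "k \<equiv> \<lambda>a b. conn G x a b (\<lambda>m. u m x)" and "N \<equiv> norm_u x"
  shows "ctr H x (\<lambda>m n. christoffel1 H m c a x * christoffel1 H n d b x)
    = (\<omega> x * \<omega> x) * (ctr G x (\<lambda>m n. \<Gamma> m c a * \<Gamma> n d b) + v d * \<Gamma> b c a + v b * \<Gamma> d c a - g d b * k c a
      + v c * (\<Gamma> a d b + v d * g b a + v b * g d a - v a * g d b)
      + v a * (\<Gamma> c d b + v d * g b c + v b * g d c - v c * g d b)
      - g c a * (k d b + 2 * v d * v b - g d b * N))"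
proof -
  let ?P = "\<lambda>m. \<Gamma> m c a + v c * g a m + v a * g c m - u m x * g c a"
  let ?Q = "\<lambda>n. \<Gamma> n d b + v d * g b n + v b * g d n - u n x * g d b"
  have k: "ctr G x (\<lambda>m n. u m x * \<Gamma> n p q) = k p q" for p q
    by (simp add: k_def \<Gamma>_def conn_eq_ctr mult.commute)
  \<comment> \<open>Same expansion for the right factor, moved to the left and back by symmetry of
    the contraction.\<close>
  have Q: "ctr G x (\<lambda>m n. F m * ?Q n) = ctr G x (\<lambda>m n. F m * \<Gamma> n d b) + v d * F b + v b * F d
      - g d b * ctr G x (\<lambda>m n. u m x * F n)" for F
  proof -
    have "ctr G x (\<lambda>m n. F m * ?Q n) = ctr G x (\<lambda>m n. ?Q m * F n)"
      by (rule ctr_prod_commute[OF x])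
    also have "\<dots> = ctr G x (\<lambda>m n. \<Gamma> m d b * F n) + v d * F b + v b * F d
      - g d b * ctr G x (\<lambda>m n. u m x * F n)"
      unfolding g_def by (rule ctr_conformal_left[OF x])
    also have "ctr G x (\<lambda>m n. \<Gamma> m d b * F n) = ctr G x (\<lambda>m n. F m * \<Gamma> n d b)"
      by (rule ctr_prod_commute[OF x])
    finally show ?thesis .
  qed
  have 1: "ctr G x (\<lambda>m n. \<Gamma> m c a * ?Q n)
      = ctr G x (\<lambda>m n. \<Gamma> m c a * \<Gamma> n d b) + v d * \<Gamma> b c a + v b * \<Gamma> d c a - g d b * k c a"
    unfolding Q k ..
  have 2: "ctr G x (\<lambda>m n. u m x * ?Q n) = k d b + 2 * v d * v b - g d b * N"
    unfolding Q k by (simp add: v_def N_def norm_u_def)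
  have "ctr H x (\<lambda>m n. christoffel1 H m c a x * christoffel1 H n d b x)
      = (\<omega> x * \<omega> x) * ctr G x (\<lambda>m n. ?P m * ?Q n)"
  proof -
    have "(\<lambda>m n. christoffel1 H m c a x * christoffel1 H n d b x)
        = (\<lambda>m n. ((\<omega> x * \<omega> x) * (\<omega> x * \<omega> x)) * (?P m * ?Q n))"
      by (simp add: fun_eq_iff christoffel1_H[OF x] \<Gamma>_def v_def g_def)
    then show ?thesis using \<omega>_nonzero[OF x] by (simp add: ctr_H[OF x] ctr_cmult)
  qed
  also have "ctr G x (\<lambda>m n. ?P m * ?Q n) = ctr G x (\<lambda>m n. \<Gamma> m c a * ?Q n) + v c * ?Q a + v a * ?Q c
      - g c a * ctr G x (\<lambda>m n. u m x * ?Q n)"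
    unfolding g_def by (rule ctr_conformal_left[OF x])
  finally show ?thesis unfolding 1 2 by (simp add: v_def mult.commute)
qed

lemma riemann_H:
  assumes x: "x \<in> U"
  shows "riemann H x a b c d = (\<omega> x * \<omega> x) * (riemann G x a b c d
    - (G x $ a $ c * S x b d - G x $ a $ d * S x b c - G x $ b $ c * S x a d + G x $ b $ d * S x a c))"
proof -
  \<comment> \<open>Each symmetric object is given one orientation. First-kind symbols whose first
    index is free are expanded into derivatives of the metric, so that their products with
    \<open>u\<close> cancel those from \<open>partial_partial_H\<close>.\<close>
  note gs = G_sym[OF x, of d a] G_sym[OF x, of d b] G_sym[OF x, of c a] G_sym[OF x, of c b]
    G_sym[OF x, of b a] G_sym[OF x, of d c]
  note dgs = partial_G_sym[OF x, of _ d a] partial_G_sym[OF x, of _ d b] partial_G_sym[OF x, of _ c a]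
    partial_G_sym[OF x, of _ c b] partial_G_sym[OF x, of _ b a] partial_G_sym[OF x, of _ d c]
  note us = partial_u_sym[OF x, of d a] partial_u_sym[OF x, of d b] partial_u_sym[OF x, of c a]
    partial_u_sym[OF x, of c b]
  note ks = conn_sym[OF x, of d a] conn_sym[OF x, of d b] conn_sym[OF x, of c a] conn_sym[OF x, of c b]
  show ?thesis
    unfolding H.riemann_formula[OF x] riemann_formula[OF x] christoffel1_product_H[OF x]
      partial_partial_H[OF x] S_def hess_u_def
      christoffel1_def[of G a] christoffel1_def[of G b] christoffel1_def[of G c] christoffel1_def[of G d]
      gs dgs us ks
    by (simp add: algebra_simps)
qed

section \<open>Ricci, scalar and Weyl curvature after rescaling\<close>

lemma ricci_H:
  assumes x: "x \<in> U"
  shows "ricci H x b d = ricci G x b d - 2 * S x b d - G x $ b $ d * ctr G x (S x)"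
proof -
  have "(\<lambda>a c. riemann H x a b c d) = (\<lambda>a c. (\<omega> x * \<omega> x) * (riemann G x a b c d
    - (G x $ a $ c * S x b d - G x $ a $ d * S x b c - G x $ b $ c * S x a d + G x $ b $ d * S x a c)))"
    by (intro ext riemann_H[OF x])
  then have "ricci H x b d = ctr G x (\<lambda>a c. riemann G x a b c d
    - (G x $ a $ c * S x b d - G x $ a $ d * S x b c - G x $ b $ c * S x a d + G x $ b $ d * S x a c))"
    using \<omega>_nonzero[OF x] by (simp add: H.ricci_eq_ctr[OF x] ctr_H[OF x] ctr_cmult)
  then show ?thesis
    by (simp only: ctr_linear ctr_metric[OF x] ricci_eq_ctr[OF x])
qed

lemma scalar_curv_H:
  assumes x: "x \<in> U"
  shows "scalar_curv H x = (scalar_curv G x - 6 * ctr G x (S x)) / (\<omega> x * \<omega> x)"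
proof -
  have "ricci H x = (\<lambda>b d. ricci G x b d - 2 * S x b d - G x $ b $ d * ctr G x (S x))"
    by (intro ext ricci_H[OF x])
  then have "scalar_curv H x
      = ctr G x (\<lambda>b d. ricci G x b d - 2 * S x b d - G x $ b $ d * ctr G x (S x)) / (\<omega> x * \<omega> x)"
    by (simp only: H.scalar_curv_eq_ctr ctr_H[OF x])
  then show ?thesis
    by (simp only: ctr_linear ctr_metric[OF x] scalar_curv_eq_ctr) simp
qed

lemma weyl_H:
  assumes x: "x \<in> U"
  shows "weyl H x a b c d = (\<omega> x * \<omega> x) * weyl G x a b c d"
proof -
  define t R where "t = ctr G x (S x)" and "R = scalar_curv G x"
  \<comment> \<open>With components abstracted to independent reals, the cancellation of
    \<open>S\<close> and of its trace is a rational identity in \<open>w \<noteq> 0\<close>.\<close>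
  have "w * (Rm - (g1 * s1 - g2 * s2 - g3 * s3 + g4 * s4))
      - 1 / 2 * (w * g1 * (r1 - 2 * s1 - g4 * t) - w * g2 * (r2 - 2 * s2 - g3 * t)
          - w * g3 * (r3 - 2 * s3 - g2 * t) + w * g4 * (r4 - 2 * s4 - g1 * t))
      + 1 / 6 * ((R - 6 * t) / w) * (w * g1 * (w * g4) - w * g2 * (w * g3))
    = w * (Rm - 1 / 2 * (g1 * r1 - g2 * r2 - g3 * r3 + g4 * r4) + 1 / 6 * R * (g1 * g4 - g2 * g3))"
    if "w \<noteq> 0" for w Rm g1 g2 g3 g4 r1 r2 r3 r4 s1 s2 s3 s4 :: real
    using that by (simp add: field_simps)
  then show ?thesis
    unfolding weyl_def riemann_H[OF x] ricci_H[OF x] scalar_curv_H[OF x] H_nth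
      t_def[symmetric] R_def[symmetric]
    using \<omega>_nonzero[OF x] by simp
qed

text \<open>The Hessian of \<open>\<omega>\<close> differs from \<open>\<omega>\<close> times
  \<open>S\<close> by a term of trace \<open>2 * norm_u x - (1/2) * norm_u x * 4\<close>, which
  vanishes in dimension four.\<close>

lemma box_\<omega>:
  assumes x: "x \<in> U"
  shows "box G \<omega> x = \<omega> x * ctr G x (S x)"
proof -
  have "hessian G \<omega> x a b = \<omega> x * (S x a b + 2 * (u a x * u b x) - (1/2) * norm_u x * G x $ a $ b)" for a b
  proof -
    have "partial a (partial b \<omega>) x = partial a (\<lambda>y. \<omega> y * u b y) x"
      using partial_\<omega> by (intro partial_cong[OF open_U x]) simp
    then have "partial a (partial b \<omega>) x = \<omega> x * (u a x * u b x + partial a (u b) x)"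
      by (simp add: partial_mult differentiable_\<omega>[OF x] differentiable_u[OF x] partial_\<omega>[OF x]
          algebra_simps)
    then show ?thesis
      unfolding hessian_def cov_deriv1 cov_deriv0 partial_\<omega>[OF x] conn_cmult S_def hess_u_def
      by (simp add: algebra_simps)
  qed
  then have "box G \<omega> x = ctr G x (\<lambda>a b. \<omega> x * (S x a b + 2 * (u a x * u b x) - (1/2) * norm_u x * G x $ a $ b))"
    by (simp add: box_def ctr_def)
  also have "\<dots> = \<omega> x * (ctr G x (S x) + 2 * norm_u x - (1/2) * norm_u x * 4)"
    by (simp only: ctr_linear ctr_metric[OF x] norm_u_def)
  finally show ?thesis by simp
qed

subsection \<open>Conformal covariance of the Bach tensor\<close>

text \<open>\<open>V x [a, c, b]\<close> is \<open>u\<^sup>d C\<^bsub>acbd\<^esub>\<close>.\<close>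

definition V :: "real^4 \<Rightarrow> 4 list \<Rightarrow> real" where
  "V y idx = ctr G y (\<lambda>d f. u f y * weyl G y (idx ! 0) (idx ! 1) (idx ! 2) d)"

lemma V_antisym:
  assumes "x \<in> U" shows "V x [b, a, c] = - V x [a, b, c]"
  unfolding V_def nth_Cons_0 by (simp add: weyl_likeD(1)[OF weyl_weyl_like[OF assms], of b] ctr_minus)

lemma V_cyclic:
  assumes "x \<in> U"
  shows "V x [a, b, c] + V x [b, c, a] + V x [c, a, b] = 0"
proof -
  \<comment> \<open>The cyclic identity fixes the first slot; pair symmetry and the antisymmetries
    carry it over to a fixed last slot.\<close>
  have "weyl G x a b c d + weyl G x b c a d + weyl G x c a b d = 0" for d
    using weyl_likeD(4)[OF weyl_weyl_like[OF assms], of d a b c]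
      weyl_likeD(3)[OF weyl_weyl_like[OF assms]] weyl_likeD(1)[OF weyl_weyl_like[OF assms]]
      weyl_likeD(2)[OF weyl_weyl_like[OF assms]]
    by (smt (verit))
  then have "ctr G x (\<lambda>d f. u f x * (weyl G x a b c d + weyl G x b c a d + weyl G x c a b d)) = 0"
    by (simp add: ctr_zero)
  then show ?thesis
    by (simp add: V_def distrib_left ctr_add)
qed

text \<open>The coefficient -2 is 2 from differentiating \<omega>^2 minus 1 from the connection term
  of each of the four slots.\<close>

lemma cov_deriv_H_weyl:
  assumes x: "x \<in> U"
  shows "cov_deriv H (weyl_tensor H) x [f, a, c, b, d] = (\<omega> x * \<omega> x) *
    (cov_deriv G (weyl_tensor G) x [f, a, c, b, d] - 2 * (u f x * weyl G x a c b d)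
      - u a x * weyl G x f c b d - u c x * weyl G x a f b d
      - u b x * weyl G x a c f d - u d x * weyl G x a c b f
      - G x $ f $ a * V x [b, d, c] + G x $ f $ c * V x [b, d, a]
      - G x $ f $ b * V x [a, c, d] + G x $ f $ d * V x [a, c, b])"
proof -
  note W = weyl_likeD[OF weyl_weyl_like[OF x]]
  have dW: "(\<lambda>y. weyl G y a b c d) differentiable (at x)" for a b c d
    using smooth_on_differentiable[OF smooth_weyl x] .
  \<comment> \<open>Contraction of \<open>u\<close> with any slot of the Weyl tensor is brought back
    to \<open>V\<close>.\<close>
  have V1: "ctr G x (\<lambda>m n. u n x * weyl G x p q r m) = V x [p, q, r]" for p q r
    by (simp add: V_def)
  have V2: "ctr G x (\<lambda>m n. u n x * weyl G x p q m r) = - V x [p, q, r]" for p q r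
    unfolding W(2)[of p q _ r] V1[symmetric] by (simp add: ctr_minus)
  have V3: "ctr G x (\<lambda>m n. u n x * weyl G x p m q r) = V x [q, r, p]" for p q r
    unfolding W(3)[where c = p and a = q and b = r] by (rule V1)
  have V4: "ctr G x (\<lambda>m n. u n x * weyl G x m p q r) = - V x [q, r, p]" for p q r
    unfolding W(3)[where d = p and a = q and b = r] by (rule V2)
  have "partial f (\<lambda>y. weyl H y a c b d) x = partial f (\<lambda>y. (\<omega> y * \<omega> y) * weyl G y a c b d) x"
    by (intro partial_cong[OF open_U x]) (rule weyl_H)
  then have 1: "partial f (\<lambda>y. weyl H y a c b d) x
      = (\<omega> x * \<omega> x) * (2 * u f x * weyl G x a c b d + partial f (\<lambda>y. weyl G y a c b d) x)"
    by (simp only: partial_scaled[OF x dW])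
  show ?thesis
    unfolding cov_deriv4 weyl_tensor_Cons H.weyl_tensor_Cons 1 weyl_H[OF x] conn_cmult conn_H[OF x]
      V1 V2 V3 V4
    by (simp add: algebra_simps)
qed

text \<open>The terms in \<open>V x [a, c, b]\<close> have total coefficient -2 - 1 - 1 + 4 = 0; the
  two permuted terms that remain combine to one copy of it by the cyclic identity.\<close>

lemma div_weyl_H:
  assumes x: "x \<in> U"
  shows "H.div_weyl x [a, c, b] = div_weyl x [a, c, b] + V x [a, c, b]"
proof -
  note tr = weyl_like_trace[OF x weyl_weyl_like[OF x]]
  have V: "ctr G x (\<lambda>d f. u f x * weyl G x a c b d) = V x [a, c, b]"
    "ctr G x (\<lambda>d f. u d x * weyl G x a c b f) = V x [a, c, b]"
    using ctr_swap[OF x, of "\<lambda>d f. u f x * weyl G x a c b d"] by (simp_all add: V_def)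
  have "H.div_weyl x [a, c, b] = ctr G x (\<lambda>d f. cov_deriv G (weyl_tensor G) x [f, a, c, b, d]
      - 2 * (u f x * weyl G x a c b d)
      - u a x * weyl G x f c b d - u c x * weyl G x a f b d
      - u b x * weyl G x a c f d - u d x * weyl G x a c b f
      - G x $ f $ a * V x [b, d, c] + G x $ f $ c * V x [b, d, a]
      - G x $ f $ b * V x [a, c, d] + G x $ f $ d * V x [a, c, b])"
    using \<omega>_nonzero[OF x]
    by (simp add: H.div_weyl_def ctr_H[OF x] cov_deriv_H_weyl[OF x] ctr_cmult del: cov_deriv.simps)
  also have "\<dots> = div_weyl x [a, c, b] - V x [b, a, c] + V x [b, c, a]"
  proof -
    have G4: "ctr G x (\<lambda>d f. G x $ f $ d) = 4"
      using ctr_G[OF x] ctr_swap[OF x, of "\<lambda>d f. G x $ f $ d"] by simp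
    show ?thesis
      by (simp add: ctr_linear ctr_metric[OF x] tr V G4 div_weyl_def del: cov_deriv.simps)
  qed
  also have "\<dots> = div_weyl x [a, c, b] + V x [a, c, b]"
    using V_antisym[OF x, of b a c] V_antisym[OF x, of c a b] V_cyclic[OF x, of a b c] by linarith
  finally show ?thesis .
qed

lemma smooth_V: "smooth_on U (\<lambda>y. V y idx)"
  unfolding V_def by (intro smooth_ctr smooth_on_mult open_U smooth_u smooth_weyl)

lemma smooth_div_weyl: "smooth_on U (\<lambda>y. div_weyl y idx)"
  unfolding div_weyl_def by (intro smooth_ctr smooth_cov_deriv smooth_weyl_tensor)

text \<open>Stated for any rank-three tensor with the symmetries shared by \<open>div_weyl\<close>
  and \<open>V\<close>. The coefficient of the first correction is -3 - 1 - 1 + 4 = -1.\<close>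

lemma ctr_cov_deriv_H:
  assumes x: "x \<in> U" and anti: "\<And>a b c. T x [b, a, c] = - T x [a, b, c]"
    and tr: "ctr G x (\<lambda>c e. T x [a, c, e]) = 0"
  shows "ctr H x (\<lambda>c e. cov_deriv H T x [e, a, c, b])
    = (ctr G x (\<lambda>c e. cov_deriv G T x [e, a, c, b]) - ctr G x (\<lambda>c e. u e x * T x [a, c, b])
       + ctr G x (\<lambda>c e. u e x * T x [a, b, c])) / (\<omega> x * \<omega> x)"
proof -
  let ?W = "\<lambda>a b. ctr G x (\<lambda>c e. u e x * T x [a, c, b])"
  let ?Z = "\<lambda>a b. ctr G x (\<lambda>c e. u e x * T x [a, b, c])"
  have W1: "ctr G x (\<lambda>m n. u n x * T x [m, c, b]) = - ?W c b" for c b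
    unfolding anti[of _ c] by (simp add: ctr_minus)
  have 0: "ctr G x (\<lambda>c e. T x [e, c, b]) = 0"
    by (rule ctr_antisym[OF x]) (rule anti)
  have s: "ctr G x (\<lambda>c e. u c x * T x [a, e, b]) = ?W a b"
    using ctr_swap[OF x, of "\<lambda>c e. u e x * T x [a, c, b]"] by simp
  have G4: "ctr G x (\<lambda>d f. G x $ f $ d) = 4"
    using ctr_G[OF x] ctr_swap[OF x, of "\<lambda>d f. G x $ f $ d"] by simp
  have "ctr G x (\<lambda>c e. cov_deriv H T x [e, a, c, b])
      = ctr G x (\<lambda>c e. cov_deriv G T x [e, a, c, b] - 3 * (u e x * T x [a, c, b])
        - u a x * T x [e, c, b] - u c x * T x [a, e, b] - u b x * T x [a, c, e]
        - G x $ e $ a * ?W c b + G x $ e $ c * ?W a b + G x $ e $ b * ?Z a c)"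
    unfolding cov_deriv3 conn_H[OF x] W1 by (simp add: algebra_simps)
  also have "\<dots> = ctr G x (\<lambda>c e. cov_deriv G T x [e, a, c, b]) - 3 * ?W a b - ?W a b - ?W a b + 4 * ?W a b
      + ?Z a b"
    unfolding ctr_linear ctr_metric[OF x] 0 tr s G4 by simp
  finally show ?thesis by (simp add: ctr_H[OF x] del: cov_deriv.simps)
qed

lemma div_weyl_properties:
  assumes x: "x \<in> U"
  shows "div_weyl x [b, a, c] = - div_weyl x [a, b, c]"
    and "ctr G x (\<lambda>c e. div_weyl x [a, c, e]) = 0"
    and "div_weyl x [a, b, c] + div_weyl x [b, c, a] + div_weyl x [c, a, b] = 0"
proof -
  define E where "E = (\<lambda>f a b c d. cov_deriv G (weyl_tensor G) x [f, a, b, c, d])"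
  have E: "weyl_like G x (E f)" for f
    unfolding E_def using weyl_like_cov_deriv_weyl[OF x] .
  have D: "div_weyl x [a, b, c] = ctr G x (\<lambda>d f. E f a b c d)" for a b c
    by (simp add: div_weyl_def E_def del: cov_deriv.simps)
  show "div_weyl x [b, a, c] = - div_weyl x [a, b, c]"
    unfolding D by (simp add: weyl_likeD(1)[OF E, of _ b] ctr_minus)
  show "ctr G x (\<lambda>c e. div_weyl x [a, c, e]) = 0"
    \<comment> \<open>With the contractions exchanged, the inner one is a trace of the
      differentiated Weyl tensor.\<close>
    unfolding D by (subst ctr_ctr) (simp add: weyl_like_trace(3)[OF x E] ctr_zero)
  have "E f a b c d + E f b c a d + E f c a b d = 0" for f d
    using weyl_likeD(4)[OF E[of f], of d a b c]
      weyl_likeD(3)[OF E[of f]] weyl_likeD(1)[OF E[of f]] weyl_likeD(2)[OF E[of f]]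
    by (smt (verit))
  then have "ctr G x (\<lambda>d f. E f a b c d + E f b c a d + E f c a b d) = 0"
    by (simp add: ctr_zero)
  then show "div_weyl x [a, b, c] + div_weyl x [b, c, a] + div_weyl x [c, a, b] = 0"
    by (simp add: D ctr_add)
qed

text \<open>Leibniz rule for \<open>u\<close> times the Weyl tensor, seen as one rank-five tensor
  before contraction. In the second term pair symmetry puts the derivative index opposite the last
  slot, which makes it a \<open>div_weyl\<close>.\<close>

lemma div_V:
  assumes x: "x \<in> U"
  shows "ctr G x (\<lambda>c e. cov_deriv G V x [e, a, c, b])
    = ctr G x (\<lambda>c e. ctr G x (\<lambda>d f. hess_u x e f * weyl G x a c b d))
      + ctr G x (\<lambda>d f. u f x * div_weyl x [b, d, a])"
proof -
  let ?T = "\<lambda>y idx. u (idx ! 0) y * weyl G y (idx ! 1) (idx ! 2) (idx ! 3) (idx ! 4)"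
  define E where "E = (\<lambda>f a b c d. cov_deriv G (weyl_tensor G) x [f, a, b, c, d])"
  have E: "weyl_like G x (E f)" for f
    unfolding E_def using weyl_like_cov_deriv_weyl[OF x] .
  have dW: "(\<lambda>y. weyl G y a b c d) differentiable (at x)" for a b c d
    using smooth_on_differentiable[OF smooth_weyl x] .
  have T: "smooth_on U (\<lambda>y. ?T y idx)" for idx
    by (intro smooth_on_mult open_U smooth_u smooth_weyl)
  have V: "cov_deriv G V x [e, a, c, b] = ctr G x (\<lambda>d f. cov_deriv G ?T x [e, f, a, c, b, d])" for e c
  proof -
    have "cov_deriv G V x [e, a, c, b]
        = cov_deriv G (\<lambda>y idx. ctr G y (\<lambda>d f. ?T y [f, idx ! 0, idx ! 1, idx ! 2, d])) x [e, a, c, b]"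
      by (rule cov_deriv_cong[OF open_U x]) (simp add: V_def)
    also have "\<dots> = ctr G x (\<lambda>d f. cov_deriv G ?T x [e, f, a, c, b, d])"
      by (rule cov_deriv_ctr[OF x T, symmetric])
    finally show ?thesis .
  qed
  have uW: "cov_deriv G ?T x [e, f, a, c, b, d] = hess_u x e f * weyl G x a c b d + u f x * E e a c b d"
    for e f c d
    unfolding cov_deriv5 E_def cov_deriv4 weyl_tensor_Cons hess_u_def
    by (simp add: partial_mult differentiable_u[OF x] dW conn_cmult conn_multc algebra_simps)
  have "ctr G x (\<lambda>c e. cov_deriv G V x [e, a, c, b])
      = ctr G x (\<lambda>c e. ctr G x (\<lambda>d f. hess_u x e f * weyl G x a c b d))
        + ctr G x (\<lambda>c e. ctr G x (\<lambda>d f. u f x * E e a c b d))"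
    unfolding V uW ctr_add ..
  also have "ctr G x (\<lambda>c e. ctr G x (\<lambda>d f. u f x * E e a c b d))
      = ctr G x (\<lambda>d f. ctr G x (\<lambda>c e. u f x * E e b d a c))"
  proof -
    have "E e a c b d = E e b d a c" for e c d
      by (rule weyl_likeD(3)[OF E])
    then have "ctr G x (\<lambda>c e. ctr G x (\<lambda>d f. u f x * E e a c b d))
        = ctr G x (\<lambda>c e. ctr G x (\<lambda>d f. u f x * E e b d a c))"
      by (intro arg_cong[where f = "ctr G x"] ext) (rule arg_cong)
    also have "\<dots> = ctr G x (\<lambda>d f. ctr G x (\<lambda>c e. u f x * E e b d a c))"
      by (rule ctr_ctr)
    finally show ?thesis .
  qed
  also have "\<dots> = ctr G x (\<lambda>d f. u f x * div_weyl x [b, d, a])"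
    by (simp add: ctr_cmult div_weyl_def E_def del: cov_deriv.simps)
  finally show ?thesis .
qed

lemma bach_H:
  assumes x: "x \<in> U"
  shows "bach H x a b = bach G x a b / (\<omega> x * \<omega> x)"
proof -
  note tr = weyl_like_trace[OF x weyl_weyl_like[OF x]]
  note D = div_weyl_properties[OF x]
  let ?D = "div_weyl" and ?T = "\<lambda>y idx. div_weyl y idx + V y idx"
  let ?hC = "ctr G x (\<lambda>c e. ctr G x (\<lambda>d f. hess_u x e f * weyl G x a c b d))"
  let ?uC = "ctr G x (\<lambda>c e. ctr G x (\<lambda>d f. u e x * u f x * weyl G x a c b d))"
  let ?RC = "ctr G x (\<lambda>c e. ctr G x (\<lambda>d f. ricci G x e f * weyl G x a c b d))"
  have V_tr: "ctr G x (\<lambda>c e. V x [a, c, e]) = 0" for a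
    by (simp add: V_def) (subst ctr_ctr, simp add: tr ctr_cmult ctr_zero)
  \<comment> \<open>\<open>div_weyl_H\<close> speaks of three-entry lists, so the derivative is
    compared after unfolding at rank three.\<close>
  have "cov_deriv H H.div_weyl x [e, a, c, b] = cov_deriv H ?T x [e, a, c, b]" for e c
  proof -
    have "partial e (\<lambda>y. H.div_weyl y [a, c, b]) x = partial e (\<lambda>y. ?T y [a, c, b]) x"
      by (intro partial_cong[OF open_U x]) (rule div_weyl_H)
    then show ?thesis unfolding cov_deriv3 div_weyl_H[OF x] by simp
  qed
  then have "ctr H x (\<lambda>c e. cov_deriv H H.div_weyl x [e, a, c, b])
      = ctr H x (\<lambda>c e. cov_deriv H ?T x [e, a, c, b])"
    by (simp only:)
  also have "\<dots> = (ctr G x (\<lambda>c e. cov_deriv G ?T x [e, a, c, b]) - ctr G x (\<lambda>c e. u e x * ?T x [a, c, b])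
       + ctr G x (\<lambda>c e. u e x * ?T x [a, b, c])) / (\<omega> x * \<omega> x)"
  proof (rule ctr_cov_deriv_H[OF x, where T = ?T])
    show "?T x [q, p, r] = - ?T x [p, q, r]" for p q r
      using D(1)[of q p r] V_antisym[OF x, of q p r] by simp
    show "ctr G x (\<lambda>c e. ?T x [a, c, e]) = 0"
      by (simp only: ctr_add D(2) V_tr)
  qed
  also have "ctr G x (\<lambda>c e. cov_deriv G ?T x [e, a, c, b])
      = ctr G x (\<lambda>c e. cov_deriv G div_weyl x [e, a, c, b]) + ?hC
        + ctr G x (\<lambda>d f. u f x * div_weyl x [b, d, a])"
  proof -
    have "cov_deriv G ?T x [e, a, c, b] = cov_deriv G div_weyl x [e, a, c, b] + cov_deriv G V x [e, a, c, b]"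
      for e c
      unfolding cov_deriv3
      using smooth_on_differentiable[OF smooth_div_weyl x] smooth_on_differentiable[OF smooth_V x]
      by (simp add: partial_add conn_add)
    then show ?thesis by (simp only: ctr_add div_V[OF x])
  qed
  also have "ctr G x (\<lambda>c e. u e x * ?T x [a, c, b]) = ctr G x (\<lambda>c e. u e x * div_weyl x [a, c, b]) + ?uC"
    by (simp add: distrib_left ctr_add V_def mult.assoc ctr_cmult)
  also have "ctr G x (\<lambda>c e. u e x * ?T x [a, b, c]) = ctr G x (\<lambda>c e. u e x * div_weyl x [a, b, c])"
  proof -
    \<comment> \<open>Symmetric \<open>u u\<close> against the antisymmetric last pair of the Weyl
      tensor: \<open>?X\<close> equals its own negative.\<close>
    let ?X = "ctr G x (\<lambda>c e. ctr G x (\<lambda>d f. u e x * u f x * weyl G x a b c d))"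
    have "?X = ctr G x (\<lambda>d f. ctr G x (\<lambda>c e. u e x * u f x * weyl G x a b c d))"
      by (rule ctr_ctr)
    also have "\<dots> = ctr G x (\<lambda>d f. ctr G x (\<lambda>c e. - (u f x * u e x * weyl G x a b d c)))"
    proof (intro arg_cong[where f = "ctr G x"] ext)
      show "u e x * u f x * weyl G x a b c d = - (u f x * u e x * weyl G x a b d c)" for c d e f
        using weyl_likeD(2)[OF weyl_weyl_like[OF x], of a b c d] by simp
    qed
    also have "\<dots> = - ?X"
      by (simp only: ctr_minus)
    finally have "?X = 0" by simp
    moreover have "ctr G x (\<lambda>c e. u e x * V x [a, b, c]) = ?X"
      by (simp add: V_def mult.assoc ctr_cmult)
    ultimately show ?thesis
      by (simp add: distrib_left ctr_add)
  qed
  finally have *: "ctr H x (\<lambda>c e. cov_deriv H H.div_weyl x [e, a, c, b]) =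
      (ctr G x (\<lambda>c e. cov_deriv G ?D x [e, a, c, b]) + ?hC + ctr G x (\<lambda>d f. u f x * ?D x [b, d, a])
       - (ctr G x (\<lambda>c e. u e x * ?D x [a, c, b]) + ?uC)
       + ctr G x (\<lambda>c e. u e x * ?D x [a, b, c])) / (\<omega> x * \<omega> x)" .
  \<comment> \<open>The terms coupling \<open>u\<close> to \<open>div_weyl\<close>, one from
    \<open>div_V\<close> and two from the change of connection, form exactly a cyclic sum.\<close>
  have "?D x [b, c, a] - ?D x [a, c, b] + ?D x [a, b, c] = 0" for c
    using D(3)[of a b c] D(1)[of c a b] by linarith
  then have "ctr G x (\<lambda>c e. u e x * (?D x [b, c, a] - ?D x [a, c, b] + ?D x [a, b, c])) = 0"
    by (simp add: ctr_zero)
  then have "ctr G x (\<lambda>d f. u f x * ?D x [b, d, a]) - ctr G x (\<lambda>c e. u e x * ?D x [a, c, b])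
      + ctr G x (\<lambda>c e. u e x * ?D x [a, b, c]) = 0"
    by (simp only: distrib_left right_diff_distrib ctr_add ctr_diff)
  moreover have "p = q - r" if "p - q + r = 0" for p q r :: real
    using that by simp
  ultimately have 0: "ctr G x (\<lambda>d f. u f x * ?D x [b, d, a])
      = ctr G x (\<lambda>c e. u e x * ?D x [a, c, b]) - ctr G x (\<lambda>c e. u e x * ?D x [a, b, c])"
    by blast
  have 1: "ctr H x (\<lambda>c e. cov_deriv H H.div_weyl x [e, a, c, b])
      = (ctr G x (\<lambda>c e. cov_deriv G ?D x [e, a, c, b]) + ?hC - ?uC) / (\<omega> x * \<omega> x)"
    unfolding * 0 by simp
  \<comment> \<open>Of the change in the Ricci tensor only \<open>- 2 * S\<close> without its metric
    part survives contraction with the trace-free Weyl tensor. The factor 1/2 in the Bach tensor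
    makes it cancel \<open>?hC - ?uC\<close>.\<close>
  have 2: "ctr H x (\<lambda>c e. ctr H x (\<lambda>d f. ricci H x e f * weyl H x a c b d))
      = (?RC - 2 * ?hC + 2 * ?uC) / (\<omega> x * \<omega> x)"
  proof -
    have "ctr H x (\<lambda>c e. ctr H x (\<lambda>d f. ricci H x e f * weyl H x a c b d))
        = ctr G x (\<lambda>c e. ctr G x (\<lambda>d f. ricci H x e f * weyl G x a c b d)) / (\<omega> x * \<omega> x)"
    proof -
      have "ctr H x (\<lambda>d f. ricci H x e f * weyl H x a c b d) = ctr G x (\<lambda>d f. ricci H x e f * weyl G x a c b d)"
        for c e
      proof -
        have "(\<lambda>d f. ricci H x e f * weyl H x a c b d)
            = (\<lambda>d f. (\<omega> x * \<omega> x) * (ricci H x e f * weyl G x a c b d))"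
          by (simp add: fun_eq_iff weyl_H[OF x])
        then show ?thesis using \<omega>_nonzero[OF x] by (simp add: ctr_H[OF x] ctr_cmult)
      qed
      then show ?thesis by (simp add: ctr_H[OF x])
    qed
    also have "ctr G x (\<lambda>c e. ctr G x (\<lambda>d f. ricci H x e f * weyl G x a c b d))
        = ctr G x (\<lambda>c e. ctr G x (\<lambda>d f. ricci G x e f * weyl G x a c b d
            - 2 * (hess_u x e f * weyl G x a c b d) + 2 * (u e x * u f x * weyl G x a c b d)
            - (norm_u x + ctr G x (S x)) * (G x $ e $ f * weyl G x a c b d)))"
      by (simp add: ricci_H[OF x] S_def algebra_simps)
    also have "\<dots> = ?RC - 2 * ?hC + 2 * ?uC"
      by (simp only: ctr_linear ctr_metric[OF x] tr)
    finally show ?thesis .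
  qed
  show ?thesis
    unfolding H.bach_eq_div_div[OF x] bach_eq_div_div[OF x] 1 2
    by (simp add: add_divide_distrib diff_divide_distrib del: cov_deriv.simps)
qed

end

section \<open>Quadratic gravity\<close>

lemma lorentzian_form_symmetric_invertible:
  assumes "lorentzian_form A"
  shows "invertible A" and "transpose A = A"
proof -
  obtain P where P: "invertible P" "transpose P ** A ** P = minkowski"
    using assms unfolding lorentzian_form_def by blast
  let ?Q = "matrix_inv P"
  note inv = matrix_inv_mult[OF P(1)]
  have invT: "transpose ?Q ** transpose P = mat 1"
    by (metis inv(1) matrix_transpose_mul transpose_mat)
  have "transpose ?Q ** minkowski ** ?Q = (transpose ?Q ** transpose P) ** A ** (P ** ?Q)"
    unfolding P(2)[symmetric] by (simp only: matrix_mul_assoc)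
  \<comment> \<open>Undoing the congruence reduces both claims to \<open>minkowski\<close>, which is
    symmetric and its own inverse.\<close>
  then have A: "A = transpose ?Q ** minkowski ** ?Q"
    unfolding invT inv by simp
  have mT: "transpose minkowski = minkowski"
    by (simp add: minkowski_def transpose_def vec_eq_iff)
  show "transpose A = A"
    by (subst (1 2) A) (simp only: matrix_transpose_mul transpose_transpose mT matrix_mul_assoc)
  have "minkowski ** minkowski = mat 1"
  proof -
    have M: "minkowski $ i $ j = (if j = i then (if i = 0 then - 1 else 1) else 0)" for i j
      by (simp add: minkowski_def eq_commute)
    have "(\<Sum>k\<in>UNIV. minkowski $ i $ k * minkowski $ k $ j) = (if i = j then 1 else 0)" for i j
      by (simp add: M if_distrib[of "\<lambda>z. z * _"] cong: if_cong)
    then show ?thesis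
      by (simp add: matrix_matrix_mult_def mat_def vec_eq_iff)
  qed
  then have "invertible minkowski"
    using invertible_right_inverse by blast
  moreover have "invertible ?Q" "invertible (transpose ?Q)"
    using inv invT invertible_right_inverse invertible_left_inverse by blast+
  ultimately show "invertible A"
    by (subst A) (intro invertible_mult)
qed

lemma coord_metric_chart:
  assumes "smooth_4manifold M A" "lorentzian_metric A g" "c \<in> A"
  shows "coord_metric (coords c) (g c)"
proof
  show "open (coords c)"
    using assms unfolding smooth_4manifold_def is_chart_def by blast
  show "smooth_on (coords c) (\<lambda>x. g c x $ a $ b)" for a b
    using assms unfolding lorentzian_metric_def by blast
  fix x assume "x \<in> coords c"
  then have L: "lorentzian_form (g c x)"
    using assms unfolding lorentzian_metric_def by blast
  show "invertible (g c x)"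
    using lorentzian_form_symmetric_invertible(1)[OF L] .
  have "transpose (g c x) $ a $ b = g c x $ a $ b" for a b
    using lorentzian_form_symmetric_invertible(2)[OF L] by simp
  then show "g c x $ a $ b = g c x $ b $ a" for a b
    by (simp add: transpose_def)
qed

lemma point_in_topspace:
  assumes "smooth_4manifold M A" "c \<in> A" "x \<in> coords c"
  shows "point c x \<in> topspace M"
  using assms inv_into_into[of x "snd c" "fst c"]
  unfolding smooth_4manifold_def coords_def point_def by blast

lemma hessian_const:
  assumes "open U" "x \<in> U" "\<And>y. y \<in> U \<Longrightarrow> f y = k"
  shows "hessian G f x a b = 0"
proof -
  have 0: "partial e f y = 0" if "y \<in> U" for e y
    using partial_cong[OF assms(1) that, of f "\<lambda>y. k"] assms(3) by simp
  then have "partial a (partial b f) x = 0"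
    using partial_cong[OF assms(1,2), of "partial b f" "\<lambda>y. 0"] by simp
  then show ?thesis
    unfolding hessian_def cov_deriv1 cov_deriv0 using 0[OF assms(2)] by (simp add: conn_def)
qed

theorem mainTheorem4:
  fixes M :: "'a topology" and A :: "'a chart set" and g :: "'a tensor2"
    and \<alpha>' \<beta>' \<gamma>' \<Lambda> :: real
  assumes "\<alpha>' \<noteq> 0" and "\<beta>' \<noteq> 0" and "\<gamma>' \<noteq> 0"
    and "\<Lambda> = - (\<gamma>' / (8 * \<beta>'))"
    and "smooth_4manifold M A"
    and "lorentzian_metric A g"
  shows "(bach_flat A g \<longrightarrow>
           (\<forall>\<Omega>. smooth_function A \<Omega> \<longrightarrow> (\<forall>p\<in>topspace M. \<Omega> p \<noteq> 0) \<longrightarrow>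
              conformal_factor_eq A g \<Lambda> \<Omega> \<longrightarrow>
              constant_scalar_curv A (conformal_metric \<Omega> g) (4 * \<Lambda>) \<and>
              quadratic_gravity_eq A \<alpha>' \<beta>' \<gamma>' \<Lambda> (conformal_metric \<Omega> g)))
         \<and> (einstein A g \<longrightarrow> bach_flat A g)"
proof (intro conjI impI allI)
  fix \<Omega> :: "'a \<Rightarrow> real"
  assume bach: "bach_flat A g" and smooth: "smooth_function A \<Omega>"
    and nonzero: "\<forall>p\<in>topspace M. \<Omega> p \<noteq> 0" and eq: "conformal_factor_eq A g \<Lambda> \<Omega>"
  have conf: "conformal_change (coords c) (g c) (\<Omega> \<circ> point c)" if c: "c \<in> A" for c
  proof -
    interpret coord_metric "coords c" "g c"
      using assms(5,6) c by (rule coord_metric_chart)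
    show ?thesis
      using smooth nonzero c point_in_topspace[OF assms(5) c]
      by unfold_locales (auto simp: smooth_function_def)
  qed
  have H: "conformal_metric \<Omega> g c = conformal_change.H (g c) (\<Omega> \<circ> point c)" if "c \<in> A" for c
    unfolding conformal_change.H_def[OF conf[OF that], abs_def] by (simp add: conformal_metric_def)
  have R: "scalar_curv (conformal_metric \<Omega> g c) x = 4 * \<Lambda>" if c: "c \<in> A" and x: "x \<in> coords c" for c x
  proof -
    interpret conformal_change "coords c" "g c" "\<Omega> \<circ> point c" by (rule conf[OF c])
    let ?w = "\<Omega> (point c x)" and ?t = "ctr (g c) x (S x)"
    have w: "?w \<noteq> 0" using \<omega>_nonzero[OF x] by simp
    have "6 * (?w * ?t) - scalar_curv (g c) x * ?w + 4 * \<Lambda> * ?w ^ 3 = 0"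
    proof -
      have "6 * box (g c) (\<Omega> \<circ> point c) x - scalar_curv (g c) x * ?w + 4 * \<Lambda> * ?w ^ 3 = 0"
        using eq c x unfolding conformal_factor_eq_def by blast
      then show ?thesis unfolding box_\<omega>[OF x] by simp
    qed
    \<comment> \<open>By \<open>scalar_curv_H\<close> the bracket is \<open>?w * ?w\<close> times
      the new scalar curvature, so cancelling one factor \<open>?w\<close> reveals its
      value.\<close>
    then have "?w * (scalar_curv (g c) x - 6 * ?t) = ?w * (4 * \<Lambda> * (?w * ?w))"
      by (simp add: algebra_simps power3_eq_cube)
    then have "scalar_curv (g c) x - 6 * ?t = 4 * \<Lambda> * (?w * ?w)"
      using w by simp
    then show ?thesis
      unfolding H[OF c] scalar_curv_H[OF x] using w by simp
  qed
  then show "constant_scalar_curv A (conformal_metric \<Omega> g) (4 * \<Lambda>)"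
    unfolding constant_scalar_curv_def by blast
  have B: "bach (conformal_metric \<Omega> g c) x a b = 0" if c: "c \<in> A" and x: "x \<in> coords c" for c x a b
  proof -
    interpret conformal_change "coords c" "g c" "\<Omega> \<circ> point c" by (rule conf[OF c])
    show ?thesis
      using bach c x unfolding bach_flat_def by (simp add: H[OF c] bach_H[OF x])
  qed
  have hess: "hessian G (scalar_curv (conformal_metric \<Omega> g c)) x a b = 0"
    if c: "c \<in> A" and x: "x \<in> coords c" for G c x a b
  proof -
    interpret conformal_change "coords c" "g c" "\<Omega> \<circ> point c" by (rule conf[OF c])
    show ?thesis using hessian_const[OF open_U x] R[OF c] .
  qed
  have \<gamma>: "\<gamma>' = - 8 * \<beta>' * \<Lambda>"
    using assms(2,4) by simp
  show "quadratic_gravity_eq A \<alpha>' \<beta>' \<gamma>' \<Lambda> (conformal_metric \<Omega> g)"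
    unfolding quadratic_gravity_eq_def
  proof (intro ballI allI)
    fix c x a b assume c: "c \<in> A" and x: "x \<in> coords c"
    show "\<gamma>' * (ricci (conformal_metric \<Omega> g c) x a b
        - (1/2) * scalar_curv (conformal_metric \<Omega> g c) x * conformal_metric \<Omega> g c x $ a $ b
        + \<Lambda> * conformal_metric \<Omega> g c x $ a $ b)
      - 4 * \<alpha>' * bach (conformal_metric \<Omega> g c) x a b
      + 2 * \<beta>' * (ricci (conformal_metric \<Omega> g c) x a b * scalar_curv (conformal_metric \<Omega> g c) x
        - (1/4) * scalar_curv (conformal_metric \<Omega> g c) x * conformal_metric \<Omega> g c x $ a $ b
            * scalar_curv (conformal_metric \<Omega> g c) x
        + conformal_metric \<Omega> g c x $ a $ b
            * box (conformal_metric \<Omega> g c) (scalar_curv (conformal_metric \<Omega> g c)) x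
        - hessian (conformal_metric \<Omega> g c) (scalar_curv (conformal_metric \<Omega> g c)) x b a) = 0"
      unfolding box_def R[OF c x] B[OF c x] hess[OF c x] \<gamma> by (simp add: algebra_simps)
  qed
next
  assume ein: "einstein A g"
  then obtain k where k: "constant_scalar_curv A g k"
    unfolding einstein_def by (elim conjE exE)
  show "bach_flat A g"
    unfolding bach_flat_def
  proof (intro ballI allI)
    fix c x a b assume c: "c \<in> A" and x: "x \<in> coords c"
    interpret coord_metric "coords c" "g c"
      using assms(5,6) c by (rule coord_metric_chart)
    \<comment> \<open>\<open>k\<close> is the scalar curvature, so the Einstein constant is a
      quarter of it.\<close>
    have "ricci (g c) y p q = k / 4 * g c y $ p $ q" if "y \<in> coords c" for y p q
      using ein k c that by (simp add: einstein_def constant_scalar_curv_def)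
    then show "bach (g c) x a b = 0"
      using x by (rule einstein_bach_zero)
  qed
qed

end
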